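(* Let $n\ge1$ and let $A$ and $B$ be two $n$-isoclinic skew braces in $\mathcal I_n$ such that $A_{(n)}=\Gamma_{n+1}(A)$ and $B_{(n)}=\Gamma_{n+1}(B)$. Then the groups $\Lambda_A$ and $\Lambda_B$ are $n$-isoclinic.
   Context: A skew (left) brace is a set $A$ with two group structures $(A,\cdot)$, $(A,\circ)$ such that $a\circ(b\cdot c)=(a\circ b)\cdot a^{-1}\cdot(a\circ c)$ for all $a,b,c$, where $a^{-1}$ is the inverse in $(A,\cdot)$. The two identities coincide, denoted $1$. Put $\lambda_a(b)=a^{-1}\cdot(a\circ b)$, $a*b=\lambda_a(b)\cdot b^{-1}$, $[a,b]^{\cdot}=a\cdot b\cdot a^{-1}\cdot b^{-1}$. Brace homomorphisms preserve both operations. An ideal is a subgroup of $(A,\cdot)$ stable under all $\lambda_a$ and normal in both groups. Annihilator series: $\mathrm{Ann}_0(A)=1$, $\mathrm{Ann}(A)=\mathrm{Ann}_1(A)=\{a: a*b=b*a=[a,b]^{\cdot}=1\ \forall b\in A\}$, $\mathrm{Ann}_n(A)/\mathrm{Ann}_{n-1}(A)=\mathrm{Ann}(A/\mathrm{Ann}_{n-1}(A))$; these are ideals. Lower central series: $\Gamma_1(A)=A$, and $\Gamma_n(A)$ is the subgroup of $(A,\cdot)$ generated by all $a*u$, $u*a$, $[a,u]^{\cdot}$ with $a\in A$, $u\in\Gamma_{n-1}(A)$; these are ideals. Commutator words: $M$ is the free monoid on the four symbols $X=\{\gamma,\bar\gamma,*,\bar *\}$, where $\gamma(a,b)=[a,b]^{\cdot}$,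 $\bar\gamma(a,b)=[b,a]^{\cdot}$, $*(a,b)=a*b$, $\bar *(a,b)=b*a$. For $m=\epsilon_1\cdots\epsilon_s\in M$ ($\epsilon_i\in X$), $\deg(m)=s$ and $m(a_1a_2\cdots a_{s+1})=\epsilon_1(a_1,\epsilon_2(a_2,\ldots,\epsilon_s(a_s,a_{s+1})\cdots))$. $A_{(t)}$ is the subgroup of $(A,\cdot)$ generated by all values $m(a_1\cdots a_{\deg(m)+1})$ with $m\in M$, $\deg(m)\ge t$, $a_i\in A$ (it is a sub-skew brace). $\mathcal I_n$ is the class of skew braces $A$ such that for every $m\in M$ with $\deg(m)=n$ the map $\phi^A_m:(A/\mathrm{Ann}_n(A))^{n+1}\to A_{(n)}$, $(\mathrm{Ann}_n(A)a_1,\ldots,\mathrm{Ann}_n(A)a_{n+1})\mapsto m(a_1\cdots a_{n+1})$, is well defined. Skew braces $A,B\in\mathcal I_n$ are $n$-isoclinic if there are brace isomorphisms $\xi:A/\mathrm{Ann}_n(A)\to B/\mathrm{Ann}_n(B)$ and $\theta:A_{(n)}\to B_{(n)}$ with $\theta\circ\phi^A_m=\phi^B_m\circ\xi^{n+1}$ for all $m\in M$ with $\deg(m)=n$, where $\xi^{n+1}=\xi\times\cdots\times\xi$ ($n+1$ copies). $\Lambda_A=(A,\cdot)\rtimes_{\lambda^{op}}(A,\circ)$ is the group on $A\times A$ with product $(a_1,b_1)(a_2,b_2)=(a_1\cdot\lambda^{op}_{b_1}(a_2),\,b_1\circ b_2)$, where $\lambda^{op}_a(b)=a\cdot\lambda_a(b)\cdot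 a^{-1}$ (this is an action of $(A,\circ)$ on $(A,\cdot)$ by automorphisms). Groups $G,H$ are $n$-isoclinic if there are group isomorphisms $\alpha:G/\mathrm{Z}_n(G)\to H/\mathrm{Z}_n(H)$ and $\beta:\gamma_{n+1}(G)\to\gamma_{n+1}(H)$ (upper and lower central series terms) such that $\beta([g_1,[g_2,\ldots,[g_n,g_{n+1}]\ldots]])=[h_1,[h_2,\ldots,[h_n,h_{n+1}]\ldots]]$ whenever $\alpha(\mathrm{Z}_n(G)g_i)=\mathrm{Z}_n(H)h_i$ for $1\le i\le n+1$. *)

theory Defs
  imports "HOL-Algebra.Algebra"
begin

section \<open>Skew braces\<close>

text \<open>
  A skew brace is a record extending that of its \<open>\<cdot>\<close>-group, so that \<open>\<otimes>\<close>, \<open>inv\<close>, \<open>#>\<close>, \<open>generate\<close>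
  refer to that group. As the identities of the two groups of a skew brace always coincide, a single
  field \<open>one\<close> serves for both.
\<close>

record 'a brace = "'a monoid" +
  circ :: "['a, 'a] \<Rightarrow> 'a"  (infixl \<open>\<diamondop>\<index>\<close> 70)

definition circ_group :: "('a, 'm) brace_scheme \<Rightarrow> 'a monoid" where
  "circ_group A = \<lparr>carrier = carrier A, monoid.mult = circ A, one = one A\<rparr>"

locale skew_brace = group A for A :: "('a, 'm) brace_scheme" (structure) +
  assumes circ_group: "group (circ_group A)"
    and brace_law: "\<lbrakk>a \<in> carrier A; b \<in> carrier A; c \<in> carrier A\<rbrakk>
      \<Longrightarrow> a \<diamondop> (b \<otimes> c) = (a \<diamondop> b) \<otimes> inv a \<otimes> (a \<diamondop> c)"

definition brace_hom :: "('a, 'm) brace_scheme \<Rightarrow> ('b, 'k) brace_scheme \<Rightarrow> ('a \<Rightarrow> 'b) set" where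
  "brace_hom A B = hom A B \<inter> hom (circ_group A) (circ_group B)"

definition brace_iso :: "('a, 'm) brace_scheme \<Rightarrow> ('b, 'k) brace_scheme \<Rightarrow> ('a \<Rightarrow> 'b) set" where
  "brace_iso A B = {h. h \<in> brace_hom A B \<and> bij_betw h (carrier A) (carrier B)}"

definition lambda :: "('a, 'm) brace_scheme \<Rightarrow> 'a \<Rightarrow> 'a \<Rightarrow> 'a" where
  "lambda A a b = inv\<^bsub>A\<^esub> a \<otimes>\<^bsub>A\<^esub> (a \<diamondop>\<^bsub>A\<^esub> b)"

definition star :: "('a, 'm) brace_scheme \<Rightarrow> 'a \<Rightarrow> 'a \<Rightarrow> 'a" where
  "star A a b = lambda A a b \<otimes>\<^bsub>A\<^esub> inv\<^bsub>A\<^esub> b"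

definition commutator :: "('a, 'm) monoid_scheme \<Rightarrow> 'a \<Rightarrow> 'a \<Rightarrow> 'a" where
  "commutator G a b = a \<otimes>\<^bsub>G\<^esub> b \<otimes>\<^bsub>G\<^esub> inv\<^bsub>G\<^esub> a \<otimes>\<^bsub>G\<^esub> inv\<^bsub>G\<^esub> b"

text \<open>
  The quotient by an ideal \<open>I\<close>. The cosets of \<open>I\<close> are the same in both groups, hence
  the elementwise product of cosets is the right operation for \<open>\<diamondop>\<close> as well.
\<close>

definition brace_quot :: "('a, 'm) brace_scheme \<Rightarrow> 'a set \<Rightarrow> 'a set brace" where
  "brace_quot A I = \<lparr>carrier = rcosets\<^bsub>A\<^esub> I, monoid.mult = set_mult A, one = I,
     circ = set_mult (circ_group A)\<rparr>"

definition annihilator :: "('a, 'm) brace_scheme \<Rightarrow> 'a set" where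
  "annihilator A = {a \<in> carrier A. \<forall>b \<in> carrier A.
     star A a b = \<one>\<^bsub>A\<^esub> \<and> star A b a = \<one>\<^bsub>A\<^esub> \<and> commutator A a b = \<one>\<^bsub>A\<^esub>}"

primrec Ann :: "('a, 'm) brace_scheme \<Rightarrow> nat \<Rightarrow> 'a set" where
  "Ann A 0 = {\<one>\<^bsub>A\<^esub>}"
| "Ann A (Suc n) =
     {a \<in> carrier A. Ann A n #>\<^bsub>A\<^esub> a \<in> annihilator (brace_quot A (Ann A n))}"

text \<open>The lower central series starts at index \<open>1\<close>; the value at \<open>0\<close> is never used.\<close>

fun Gamma :: "('a, 'm) brace_scheme \<Rightarrow> nat \<Rightarrow> 'a set" where
  "Gamma A 0 = carrier A"
| "Gamma A (Suc 0) = carrier A"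
| "Gamma A (Suc (Suc n)) = generate A
     (\<Union>a \<in> carrier A. \<Union>u \<in> Gamma A (Suc n). {star A a u, star A u a, commutator A a u})"


section \<open>Commutator words\<close>

datatype comm_symbol = Comm | CommBar | Star | StarBar

fun symbol_op :: "('a, 'm) brace_scheme \<Rightarrow> comm_symbol \<Rightarrow> 'a \<Rightarrow> 'a \<Rightarrow> 'a" where
  "symbol_op A Comm a b = commutator A a b"
| "symbol_op A CommBar a b = commutator A b a"
| "symbol_op A Star a b = star A a b"
| "symbol_op A StarBar a b = star A b a"

text \<open>
  Words are lists of symbols, the degree being the length. The value of a word \<open>m\<close> is
  only meaningful on lists of length \<open>length m + 1\<close>.
\<close>

primrec word_val :: "('a, 'm) brace_scheme \<Rightarrow> comm_symbol list \<Rightarrow> 'a list \<Rightarrow> 'a" where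
  "word_val A [] as = hd as"
| "word_val A (e # m) as = symbol_op A e (hd as) (word_val A m (tl as))"

definition tuples :: "'a set \<Rightarrow> nat \<Rightarrow> 'a list set" where
  "tuples S k = {as. set as \<subseteq> S \<and> length as = k}"

definition word_subgroup :: "('a, 'm) brace_scheme \<Rightarrow> nat \<Rightarrow> 'a set" where
  "word_subgroup A t = generate A
     {word_val A m as | m as. length m \<ge> t \<and> as \<in> tuples (carrier A) (length m + 1)}"

definition word_brace :: "('a, 'm) brace_scheme \<Rightarrow> nat \<Rightarrow> ('a, 'm) brace_scheme" where
  "word_brace A t = A\<lparr>carrier := word_subgroup A t\<rparr>"

definition ann_quot :: "('a, 'm) brace_scheme \<Rightarrow> nat \<Rightarrow> 'a set brace" where
  "ann_quot A n = brace_quot A (Ann A n)"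

definition ann_cosets :: "('a, 'm) brace_scheme \<Rightarrow> nat \<Rightarrow> 'a list \<Rightarrow> 'a set list" where
  "ann_cosets A n as = map (\<lambda>a. Ann A n #>\<^bsub>A\<^esub> a) as"

definition class_I :: "nat \<Rightarrow> ('a, 'm) brace_scheme \<Rightarrow> bool" where
  "class_I n A \<longleftrightarrow> skew_brace A \<and>
     (\<forall>m. length m = n \<longrightarrow>
       (\<forall>as \<in> tuples (carrier A) (n + 1). \<forall>bs \<in> tuples (carrier A) (n + 1).
          ann_cosets A n as = ann_cosets A n bs \<longrightarrow> word_val A m as = word_val A m bs))"

text \<open>The map induced by a word on tuples of cosets; it is used for members of \<^const>\<open>class_I\<close> only.\<close>

definition phi :: "('a, 'm) brace_scheme \<Rightarrow> nat \<Rightarrow> comm_symbol list \<Rightarrow> 'a set list \<Rightarrow> 'a" where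
  "phi A n m Xs = (THE y. \<exists>as \<in> tuples (carrier A) (n + 1).
     Xs = ann_cosets A n as \<and> y = word_val A m as)"

lemma phi_ann_cosets:
  assumes "class_I n A" "length m = n" "as \<in> tuples (carrier A) (n + 1)"
  shows "phi A n m (ann_cosets A n as) = word_val A m as"
  unfolding phi_def
proof (rule the_equality)
  show "\<exists>bs \<in> tuples (carrier A) (n + 1).
      ann_cosets A n as = ann_cosets A n bs \<and> word_val A m as = word_val A m bs"
    by (intro bexI[OF _ assms(3)] conjI refl)
next
  fix y
  assume "\<exists>bs \<in> tuples (carrier A) (n + 1). ann_cosets A n as = ann_cosets A n bs \<and> y = word_val A m bs"
  then obtain bs where "bs \<in> tuples (carrier A) (n + 1)" "ann_cosets A n as = ann_cosets A n bs"
    and y: "y = word_val A m bs" by (elim bexE conjE)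
  then have "word_val A m as = word_val A m bs"
    using assms(1)[unfolded class_I_def, THEN conjunct2, rule_format, OF assms(2,3)] by iprover
  then show "y = word_val A m as" using y by (rule trans[OF _ sym, rotated])
qed

lemma phi_closed:
  assumes "class_I n A" "length m = n" "as \<in> tuples (carrier A) (n + 1)"
  shows "phi A n m (ann_cosets A n as) \<in> word_subgroup A n"
  unfolding phi_ann_cosets[OF assms] word_subgroup_def
  using assms(2,3) by (intro generate.incl CollectI exI[of _ m] exI[of _ as]) simp

definition brace_isoclinic ::
    "nat \<Rightarrow> ('a, 'm) brace_scheme \<Rightarrow> ('b, 'k) brace_scheme \<Rightarrow> bool" where
  "brace_isoclinic n A B \<longleftrightarrow>
     (\<exists>\<xi> \<in> brace_iso (ann_quot A n) (ann_quot B n).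
      \<exists>\<theta> \<in> brace_iso (word_brace A n) (word_brace B n).
        \<forall>m. length m = n \<longrightarrow>
          (\<forall>Xs \<in> tuples (carrier (ann_quot A n)) (n + 1).
             \<theta> (phi A n m Xs) = phi B n m (map \<xi> Xs)))"


section \<open>The group associated with a skew brace\<close>

definition lambda_op :: "('a, 'm) brace_scheme \<Rightarrow> 'a \<Rightarrow> 'a \<Rightarrow> 'a" where
  "lambda_op A a b = a \<otimes>\<^bsub>A\<^esub> lambda A a b \<otimes>\<^bsub>A\<^esub> inv\<^bsub>A\<^esub> a"

definition Lambda_group :: "('a, 'm) brace_scheme \<Rightarrow> ('a \<times> 'a) monoid" where
  "Lambda_group A = \<lparr>carrier = carrier A \<times> carrier A,
     monoid.mult = (\<lambda>(a1, b1) (a2, b2). (a1 \<otimes>\<^bsub>A\<^esub> lambda_op A b1 a2, b1 \<diamondop>\<^bsub>A\<^esub> b2)),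
     one = (\<one>\<^bsub>A\<^esub>, \<one>\<^bsub>A\<^esub>)\<rparr>"


section \<open>Isoclinism of groups\<close>

definition group_center :: "('a, 'm) monoid_scheme \<Rightarrow> 'a set" where
  "group_center G = {z \<in> carrier G. \<forall>g \<in> carrier G. z \<otimes>\<^bsub>G\<^esub> g = g \<otimes>\<^bsub>G\<^esub> z}"

primrec upper_central :: "('a, 'm) monoid_scheme \<Rightarrow> nat \<Rightarrow> 'a set" where
  "upper_central G 0 = {\<one>\<^bsub>G\<^esub>}"
| "upper_central G (Suc n) =
     {g \<in> carrier G. upper_central G n #>\<^bsub>G\<^esub> g \<in> group_center (G Mod upper_central G n)}"

text \<open>Again the series starts at index \<open>1\<close>.\<close>

fun lower_central :: "('a, 'm) monoid_scheme \<Rightarrow> nat \<Rightarrow> 'a set" where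
  "lower_central G 0 = carrier G"
| "lower_central G (Suc 0) = carrier G"
| "lower_central G (Suc (Suc n)) = generate G
     (\<Union>g \<in> carrier G. \<Union>u \<in> lower_central G (Suc n). {commutator G g u})"

fun iter_commutator :: "('a, 'm) monoid_scheme \<Rightarrow> 'a list \<Rightarrow> 'a" where
  "iter_commutator G [] = \<one>\<^bsub>G\<^esub>"
| "iter_commutator G [g] = g"
| "iter_commutator G (g # h # gs) = commutator G g (iter_commutator G (h # gs))"

definition group_isoclinic ::
    "nat \<Rightarrow> ('a, 'm) monoid_scheme \<Rightarrow> ('b, 'k) monoid_scheme \<Rightarrow> bool" where
  "group_isoclinic n G H \<longleftrightarrow>
     (\<exists>\<alpha> \<in> iso (G Mod upper_central G n) (H Mod upper_central H n).
      \<exists>\<beta> \<in> iso (G\<lparr>carrier := lower_central G (n + 1)\<rparr>) (H\<lparr>carrier := lower_central H (n + 1)\<rparr>).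
        \<forall>gs \<in> tuples (carrier G) (n + 1). \<forall>hs \<in> tuples (carrier H) (n + 1).
          (\<forall>i < n + 1. \<alpha> (upper_central G n #>\<^bsub>G\<^esub> (gs ! i)) = upper_central H n #>\<^bsub>H\<^esub> (hs ! i)) \<longrightarrow>
            \<beta> (iter_commutator G gs) = iter_commutator H hs)"

end

theory Submission
  imports Defs
begin

text \<open>
  Write \<open>\<gamma>(G)\<close> for \<open>lower_central G (n + 1)\<close>, and let \<open>\<xi>\<close> and \<open>\<theta>\<close> be the two isomorphisms that make
  \<open>A\<close> and \<open>B\<close> isoclinic. Instead of comparing \<open>A\<close> with \<open>B\<close>, compare both with the fibre product
  \<open>P = {(a, b). \<xi> (Ann\<^sub>n(A) a) = Ann\<^sub>n(B) b}\<close>, a skew brace that projects onto \<open>A\<close> and onto \<open>B\<close>.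
  The value of a word of degree at least \<open>n\<close> on elements of \<open>P\<close> is a pair \<open>(x, \<theta> x)\<close>: a longer word
  is a word of degree \<open>n\<close> with another word value as its last argument, and for degree \<open>n\<close> this is
  the compatibility of \<open>\<xi>\<close> with \<open>\<theta>\<close>. So \<open>P\<^sub>(\<^sub>n\<^sub>)\<close>, being generated by such values, lies in the graph of
  the injective map \<open>\<theta>\<close>, and both projections are injective on \<open>P\<^sub>(\<^sub>n\<^sub>)\<close>.

  It then suffices to show, for a surjective homomorphism \<open>h\<close> of skew braces from \<open>P\<close> to \<open>A\<close> that is
  injective on \<open>P\<^sub>(\<^sub>n\<^sub>)\<close>, that \<open>\<Lambda>\<^sub>P\<close> and \<open>\<Lambda>\<^sub>A\<close> are \<open>n\<close>-isoclinic; symmetry and transitivity of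
  isoclinism do the rest. Two facts give this.

  \<^item> \<open>\<gamma>(\<Lambda>\<^sub>P) \<subseteq> P\<^sub>(\<^sub>n\<^sub>) \<times> P\<^sub>(\<^sub>n\<^sub>)\<close>, so that the induced map \<open>\<Lambda>\<^sub>P \<rightarrow> \<Lambda>\<^sub>A\<close> is injective on \<open>\<gamma>(\<Lambda>\<^sub>P)\<close>
  (\<open>lower_central_Lambda\<close>). The reason is that \<open>\<Lambda>\<^sub>P\<close> acts on its normal subgroup \<open>(P, \<cdot>)\<close> by inner
  automorphisms and by the maps \<open>\<lambda>\<^sub>a\<close>, hence trivially on each \<open>P\<^sub>(\<^sub>t\<^sub>)\<close> modulo \<open>P\<^sub>(\<^sub>t\<^sub>+\<^sub>1\<^sub>)\<close>: the values of
  \<open>*\<close> and of the commutator raise the degree. By the three subgroups argument the \<open>k\<close>-th term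
  of the lower central series of \<open>\<Lambda>\<^sub>P\<close> acts trivially on \<open>P = P\<^sub>(\<^sub>0\<^sub>)\<close> modulo \<open>P\<^sub>(\<^sub>k\<^sub>)\<close>. This controls \<open>v * a\<close> for \<open>v\<close> in a
  lower central term: that \<open>v\<close> is a product of word values does not help, as \<open>*\<close> is not multiplicative in
  its first argument.

  \<^item> A surjective group homomorphism \<open>G \<rightarrow> H\<close> that is injective on \<open>\<gamma>(G)\<close> induces an
  \<open>n\<close>-isoclinism (\<open>group_isoclinic_of_surj\<close>). Indeed \<open>g\<close> lies in the \<open>n\<close>-th centre iff all commutators
  of weight \<open>n + 1\<close> ending in \<open>g\<close> vanish, so that the preimage of the \<open>n\<close>-th centre of \<open>H\<close> is that
  of \<open>G\<close>.
\<close>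

section \<open>Commutators, normal subgroups and cosets\<close>

lemma (in group) inv_cancel_left [simp]:
  "\<lbrakk>a \<in> carrier G; x \<in> carrier G\<rbrakk> \<Longrightarrow> inv a \<otimes> (a \<otimes> x) = x"
  "\<lbrakk>a \<in> carrier G; x \<in> carrier G\<rbrakk> \<Longrightarrow> a \<otimes> (inv a \<otimes> x) = x"
  by (simp_all flip: m_assoc)

lemma (in group) commutator_closed [simp]:
  "\<lbrakk>x \<in> carrier G; y \<in> carrier G\<rbrakk> \<Longrightarrow> commutator G x y \<in> carrier G"
  by (simp add: commutator_def)

lemma (in group) commutator_mult:
  "\<lbrakk>x \<in> carrier G; y \<in> carrier G\<rbrakk> \<Longrightarrow> commutator G x y \<otimes> (y \<otimes> x) = x \<otimes> y"
  by (simp add: commutator_def m_assoc)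

lemma (in group) commutator_eq_one_iff:
  assumes "x \<in> carrier G" "y \<in> carrier G"
  shows "commutator G x y = \<one> \<longleftrightarrow> x \<otimes> y = y \<otimes> x"
proof
  assume "commutator G x y = \<one>"
  then show "x \<otimes> y = y \<otimes> x" using commutator_mult[OF assms] assms by simp
next
  assume "x \<otimes> y = y \<otimes> x"
  then show "commutator G x y = \<one>" using commutator_mult[OF assms] assms by simp
qed

lemma (in group) commutator_eqI:
  assumes "x \<in> carrier G" "y \<in> carrier G" "c \<in> carrier G" "x \<otimes> y = c \<otimes> (y \<otimes> x)"
  shows "commutator G x y = c"
proof -
  have "commutator G x y \<otimes> (y \<otimes> x) = c \<otimes> (y \<otimes> x)"
    using commutator_mult[OF assms(1,2)] assms(4) by simp
  then show ?thesis using assms(1-3) by simp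
qed

lemma (in group) inv_commutator:
  "\<lbrakk>x \<in> carrier G; y \<in> carrier G\<rbrakk> \<Longrightarrow> inv (commutator G x y) = commutator G y x"
  by (simp add: commutator_def inv_mult_group m_assoc)

lemma (in group_hom) hom_commutator:
  "\<lbrakk>x \<in> carrier G; y \<in> carrier G\<rbrakk> \<Longrightarrow> h (commutator G x y) = commutator H (h x) (h y)"
  by (simp add: commutator_def)

lemma (in normal) coset_hom: "group_hom G (G Mod H) (\<lambda>x. H #> x)"
  using factorgroup_is_group r_coset_hom_Mod by (simp add: group_hom_axioms_def group_hom_def is_group)

lemma (in normal) coset_eq_self_iff:
  "x \<in> carrier G \<Longrightarrow> H #> x = H \<longleftrightarrow> x \<in> H"
  using coset_join1[OF _ _ subgroup_axioms] coset_join2[OF _ subgroup_axioms] by blast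

lemma (in normal) coset_eq_iff:
  assumes "x \<in> carrier G" "y \<in> carrier G"
  shows "H #> x = H #> y \<longleftrightarrow> x \<otimes> inv y \<in> H"
proof -
  interpret q: group_hom G "G Mod H" "\<lambda>x. H #> x" by (rule coset_hom)
  have "x \<otimes> inv y \<in> H \<longleftrightarrow> H #> (x \<otimes> inv y) = \<one>\<^bsub>G Mod H\<^esub>"
    using assms by (simp add: coset_eq_self_iff del: q.hom_mult)
  also have "\<dots> \<longleftrightarrow> (H #> x) \<otimes>\<^bsub>G Mod H\<^esub> inv\<^bsub>G Mod H\<^esub> (H #> y) = \<one>\<^bsub>G Mod H\<^esub>"
    using assms by (simp only: q.hom_mult q.hom_inv inv_closed)
  also have "\<dots> \<longleftrightarrow> H #> x = H #> y"
    using q.H.inv_solve_right'[OF q.H.one_closed q.hom_closed[OF assms(1)] q.hom_closed[OF assms(2)]]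
      q.H.l_one[OF q.hom_closed[OF assms(2)]] by auto
  finally show ?thesis by simp
qed

lemma (in normal) commutator_mem_iff:
  assumes "x \<in> carrier G" "y \<in> carrier G"
  shows "commutator G x y \<in> H \<longleftrightarrow>
    (H #> x) \<otimes>\<^bsub>G Mod H\<^esub> (H #> y) = (H #> y) \<otimes>\<^bsub>G Mod H\<^esub> (H #> x)"
proof -
  interpret h: group_hom G "G Mod H" "\<lambda>x. H #> x" by (rule coset_hom)
  have "commutator G x y \<in> H \<longleftrightarrow> commutator (G Mod H) (H #> x) (H #> y) = \<one>\<^bsub>G Mod H\<^esub>"
    using assms coset_eq_self_iff[of "commutator G x y"] by (simp flip: h.hom_commutator)
  then show ?thesis using assms
    by (simp add: h.H.commutator_eq_one_iff h.hom_closed del: mult_FactGroup one_FactGroup)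
qed

text \<open>
  This lemma and the next one let a factor that commutes with everything in sight be dropped from
  an entry of a commutator. They are used in quotients, where such factors come from the upper
  central series.
\<close>

lemma (in group) commutator_absorb_left:
  assumes c: "z \<in> carrier G" "g \<in> carrier G" "u \<in> carrier G"
    and zu: "u \<otimes> z = z \<otimes> u" and zc: "commutator G g u \<otimes> z = z \<otimes> commutator G g u"
  shows "commutator G (z \<otimes> g) u = commutator G g u"
proof (rule commutator_eqI)
  let ?c = "commutator G g u"
  have cc: "?c \<in> carrier G" using c by simp
  have "z \<otimes> g \<otimes> u = z \<otimes> (?c \<otimes> (u \<otimes> g))"
    unfolding commutator_mult[OF c(2,3)] using c by (simp add: m_assoc)
  also have "\<dots> = (z \<otimes> ?c) \<otimes> (u \<otimes> g)" using c cc by (simp add: m_assoc)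
  also have "\<dots> = ?c \<otimes> ((z \<otimes> u) \<otimes> g)" unfolding zc[symmetric] using c cc by (simp add: m_assoc)
  also have "\<dots> = ?c \<otimes> (u \<otimes> (z \<otimes> g))" unfolding zu[symmetric] using c cc by (simp add: m_assoc)
  finally show "z \<otimes> g \<otimes> u = ?c \<otimes> (u \<otimes> (z \<otimes> g))" .
qed (use c in simp_all)

lemma (in group) commutator_absorb_right:
  assumes c: "y \<in> carrier G" "g \<in> carrier G" "u \<in> carrier G"
    and gy: "g \<otimes> y = y \<otimes> g" and yc: "commutator G g u \<otimes> y = y \<otimes> commutator G g u"
  shows "commutator G g (y \<otimes> u) = commutator G g u"
proof (rule commutator_eqI)
  let ?c = "commutator G g u"
  have cc: "?c \<in> carrier G" using c by simp
  have "g \<otimes> (y \<otimes> u) = y \<otimes> (g \<otimes> u)" using c gy by (simp flip: m_assoc)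
  also have "\<dots> = (y \<otimes> ?c) \<otimes> (u \<otimes> g)"
    unfolding commutator_mult[OF c(2,3), symmetric] using c cc by (simp add: m_assoc)
  also have "\<dots> = ?c \<otimes> (y \<otimes> u \<otimes> g)" unfolding yc[symmetric] using c cc by (simp add: m_assoc)
  finally show "g \<otimes> (y \<otimes> u) = ?c \<otimes> (y \<otimes> u \<otimes> g)" .
qed (use c in simp_all)

text \<open>
  Conjugation by \<open>x\<close> multiplies a generator \<open>s\<close> by \<open>[x, s]\<close>, so that a generating set need not be stable
  under conjugation itself, as long as these commutators are generated.
\<close>

lemma (in group) normal_generate:
  assumes S: "S \<subseteq> carrier G"
    and comm: "\<And>x s. \<lbrakk>x \<in> carrier G; s \<in> S\<rbrakk> \<Longrightarrow> commutator G x s \<in> generate G S"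
  shows "generate G S \<lhd> G"
proof (rule normal_invI[OF generate_is_subgroup[OF S]])
  interpret W: subgroup "generate G S" G by (rule generate_is_subgroup[OF S])
  fix x w assume x: "x \<in> carrier G"
  have gen: "x \<otimes> s \<otimes> inv x \<in> generate G S" if s: "s \<in> S" for s
  proof -
    have "commutator G x s \<otimes> s \<in> generate G S" using comm[OF x s] generate.incl[OF s] by (rule W.m_closed)
    then show ?thesis using x s S by (auto simp: commutator_def m_assoc)
  qed
  assume "w \<in> generate G S"
  then show "x \<otimes> w \<otimes> inv x \<in> generate G S"
  proof (induction w rule: generate.induct)
    case (inv s)
    then have "s \<in> carrier G" using S by blast
    then show ?case using W.m_inv_closed[OF gen[OF inv]] x by (simp add: inv_mult_group m_assoc)
  next
    case (eng u v)
    then have "u \<in> carrier G" "v \<in> carrier G" by (auto intro: W.mem_carrier)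
    then show ?case using W.m_closed[OF eng(3,4)] x by (simp add: m_assoc)
  qed (use x gen in \<open>simp_all add: generate.one\<close>)
qed

text \<open>
  The set on which an endomorphism agrees modulo \<open>N\<close> with the identity is a subgroup, so triviality
  modulo \<open>N\<close> can be tested on generators. It applies because both conjugations and the maps
  \<open>\<lambda>\<^sup>o\<^sup>p\<^sub>a\<close> are endomorphisms of the first group of a skew brace.
\<close>

lemma (in group) endo_trivial_mod_normal:
  assumes "group_hom G G f" and N: "N \<lhd> G" and S: "S \<subseteq> carrier G"
    and gen: "\<And>s. s \<in> S \<Longrightarrow> N #> f s = N #> s" and w: "w \<in> generate G S"
  shows "N #> f w = N #> w"
proof -
  interpret f: group_hom G G f by fact
  interpret N: normal N G by fact
  interpret q: group_hom G "G Mod N" "\<lambda>x. N #> x" by (rule N.coset_hom)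
  show ?thesis using w
  proof (induction w rule: generate.induct)
    case (inv s)
    then have "s \<in> carrier G" using S by blast
    then show ?case using gen[OF inv] by (simp only: f.hom_inv q.hom_inv f.hom_closed)
  next
    case (eng u v)
    then have "u \<in> carrier G" "v \<in> carrier G" using generate_in_carrier[OF S] by auto
    then show ?case using eng.IH by (simp only: f.hom_mult q.hom_mult f.hom_closed)
  qed (use gen in simp_all)
qed

lemma (in group) conj_hom: "a \<in> carrier G \<Longrightarrow> group_hom G G (\<lambda>x. a \<otimes> x \<otimes> inv a)"
  by (simp add: group_hom_def group_hom_axioms_def is_group hom_def Pi_def m_assoc)

lemma (in group) subgroup_centralizer:
  assumes S: "S \<subseteq> carrier G"
  shows "subgroup {x \<in> carrier G. \<forall>s \<in> S. x \<otimes> s = s \<otimes> x} G" (is "subgroup ?C G")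
proof (rule subgroupI)
  have "\<one> \<in> ?C" using S by auto
  then show "?C \<noteq> {}" by blast
next
  fix a assume a: "a \<in> ?C"
  have "inv a \<otimes> s = s \<otimes> inv a" if "s \<in> S" for s
  proof -
    have "s \<in> carrier G" "a \<in> carrier G" "a \<otimes> s = s \<otimes> a" using that S a by auto
    then show ?thesis by (metis inv_closed inv_solve_left inv_solve_right m_assoc m_closed)
  qed
  then show "inv a \<in> ?C" using a by simp
next
  fix a b assume a: "a \<in> ?C" and b: "b \<in> ?C"
  have "a \<otimes> b \<otimes> s = s \<otimes> (a \<otimes> b)" if "s \<in> S" for s
  proof -
    have c: "s \<in> carrier G" "a \<in> carrier G" "b \<in> carrier G" using that S a b by auto
    have as: "a \<otimes> s = s \<otimes> a" and bs: "b \<otimes> s = s \<otimes> b" using that a b by auto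
    have "a \<otimes> b \<otimes> s = a \<otimes> s \<otimes> b" using c bs by (simp add: m_assoc)
    then show ?thesis unfolding as using c by (simp add: m_assoc)
  qed
  then show "a \<otimes> b \<in> ?C" using a b by simp
qed auto

lemma (in group) normal_center: "group_center G \<lhd> G"
proof (rule normal_invI)
  show "subgroup (group_center G) G"
    unfolding group_center_def by (rule subgroup_centralizer) simp
next
  fix x z assume x: "x \<in> carrier G" and z: "z \<in> group_center G"
  then have c: "z \<in> carrier G" and comm: "z \<otimes> x = x \<otimes> z" by (simp_all add: group_center_def)
  have "x \<otimes> z \<otimes> inv x = z" unfolding comm[symmetric] using x c by (simp add: m_assoc)
  then show "x \<otimes> z \<otimes> inv x \<in> group_center G" using z by simp
qed

lemma (in group_hom) subgroup_preimage:
  assumes "subgroup N H"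
  shows "subgroup {x \<in> carrier G. h x \<in> N} G"
proof -
  interpret N: subgroup N H by fact
  have "\<one> \<in> {x \<in> carrier G. h x \<in> N}" by simp
  then show ?thesis by (intro G.subgroupI) auto
qed

lemma (in group_hom) normal_preimage:
  assumes "N \<lhd> H"
  shows "{x \<in> carrier G. h x \<in> N} \<lhd> G"
proof -
  interpret N: normal N H by fact
  show ?thesis
    by (rule G.normal_invI[OF subgroup_preimage[OF N.subgroup_axioms]]) (simp add: N.inv_op_closed2)
qed

section \<open>The central series of a group\<close>

lemma (in group) normal_upper_central: "upper_central G n \<lhd> G"
proof (induction n)
  case 0
  show ?case using one_is_normal by simp
next
  case (Suc n)
  interpret N: normal "upper_central G n" G by fact
  interpret h: group_hom G "G Mod upper_central G n" "\<lambda>x. upper_central G n #> x"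
    by (rule N.coset_hom)
  show ?case using h.normal_preimage[OF h.H.normal_center] by simp
qed

lemmas (in group) upper_central_in_carrier =
  subgroup.mem_carrier[OF normal_imp_subgroup[OF normal_upper_central]]

lemma (in group) mem_upper_central_Suc_iff:
  "z \<in> upper_central G (Suc n) \<longleftrightarrow>
    z \<in> carrier G \<and> (\<forall>g \<in> carrier G. commutator G g z \<in> upper_central G n)"
proof -
  interpret N: normal "upper_central G n" G by (rule normal_upper_central)
  have "z \<in> upper_central G (Suc n) \<longleftrightarrow>
    z \<in> carrier G \<and> (\<forall>g \<in> carrier G. commutator G z g \<in> upper_central G n)"
    by (auto simp: group_center_def carrier_FactGroup N.commutator_mem_iff)
  moreover have "commutator G z g \<in> upper_central G n \<longleftrightarrow> commutator G g z \<in> upper_central G n"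
    if "z \<in> carrier G" "g \<in> carrier G" for g
    using that by (metis N.m_inv_closed inv_commutator)
  ultimately show ?thesis by auto
qed

lemma (in group) upper_central_le_Suc: "upper_central G n \<subseteq> upper_central G (Suc n)"
proof
  fix z assume z: "z \<in> upper_central G n"
  interpret N: normal "upper_central G n" G by (rule normal_upper_central)
  have "commutator G g z \<in> upper_central G n" if g: "g \<in> carrier G" for g
    using N.m_closed[OF N.inv_op_closed2[OF g z] N.m_inv_closed[OF z]] by (simp add: commutator_def)
  then show "z \<in> upper_central G (Suc n)" using z by (simp add: mem_upper_central_Suc_iff del: upper_central.simps)
qed

lemma (in group) upper_central_mono: "m \<le> n \<Longrightarrow> upper_central G m \<subseteq> upper_central G n"
  by (rule lift_Suc_mono_le[of "upper_central G", OF upper_central_le_Suc])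

lemma (in group) subgroup_lower_central: "subgroup (lower_central G n) G"
proof (induction n)
  case (Suc n)
  then show ?case
  proof (cases n)
    case (Suc m)
    have "(\<Union>g \<in> carrier G. \<Union>u \<in> lower_central G (Suc m). {commutator G g u}) \<subseteq> carrier G"
      using Suc Suc.IH subgroup.mem_carrier by fastforce
    then show ?thesis using Suc by (simp add: generate_is_subgroup)
  qed (simp add: subgroup_self)
qed (simp add: subgroup_self)

lemmas (in group) lower_central_in_carrier = subgroup.mem_carrier[OF subgroup_lower_central]

lemma (in group) lower_central_Suc_gens:
  "(\<Union>g \<in> carrier G. \<Union>u \<in> lower_central G (Suc n). {commutator G g u}) \<subseteq> carrier G"
  using lower_central_in_carrier by auto

lemma (in group) lower_central_commutator:
  "\<lbrakk>g \<in> carrier G; u \<in> lower_central G (Suc n)\<rbrakk> \<Longrightarrow> commutator G g u \<in> lower_central G (Suc (Suc n))"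
  by (auto intro: generate.incl)

lemma (in group_hom) lower_central_image:
  assumes "h ` carrier G = carrier H"
  shows "h ` lower_central G n = lower_central H n"
proof (induction n)
  case 0
  show ?case using assms by simp
next
  case (Suc n)
  show ?case
  proof (cases n)
    case 0
    then show ?thesis using assms by simp
  next
    case (Suc m)
    have "h ` (\<Union>g \<in> carrier G. \<Union>u \<in> lower_central G n. {commutator G g u})
        = (\<Union>g \<in> carrier G. \<Union>u \<in> lower_central G n. {commutator H (h g) (h u)})"
      using hom_commutator G.lower_central_in_carrier[of _ n] by (auto simp: image_UN)
    also have "\<dots> = (\<Union>g \<in> carrier H. \<Union>u \<in> lower_central H n. {commutator H g u})"
      using assms Suc.IH by (auto simp flip: assms Suc.IH)
    finally show ?thesis
      using generate_img[OF G.lower_central_Suc_gens[of m]] Suc by simp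
  qed
qed

section \<open>Central filtrations\<close>

text \<open>
  A descending chain of subgroups on whose factors the whole group acts trivially. Both the upper
  central series, read downwards, and the word subgroups inside \<open>\<Lambda>\<^sub>A\<close> are of this kind.
\<close>

locale central_filtration = group G for G (structure) +
  fixes V :: "nat \<Rightarrow> 'a set"
  assumes subgroup_V: "subgroup (V t) G"
    and V_decreasing: "V (Suc t) \<subseteq> V t"
    and commutator_V: "\<lbrakk>g \<in> carrier G; v \<in> V t\<rbrakk> \<Longrightarrow> commutator G g v \<in> V (Suc t)"
begin

lemma V_in_carrier: "v \<in> V t \<Longrightarrow> v \<in> carrier G"
  by (rule subgroup.mem_carrier[OF subgroup_V])

lemma normal_V: "V t \<lhd> G"
proof (rule normal_invI[OF subgroup_V])
  fix x v assume x: "x \<in> carrier G" and v: "v \<in> V t"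
  have "commutator G x v \<otimes> v \<in> V t"
    using commutator_V[OF x v] V_decreasing v by (auto intro: subgroup.m_closed[OF subgroup_V])
  then show "x \<otimes> v \<otimes> inv x \<in> V t"
    using x V_in_carrier[OF v] by (simp add: commutator_def m_assoc)
qed

lemma commute_mod_V:
  assumes "g \<in> carrier G" "v \<in> V t"
  shows "(V (Suc t) #> g) \<otimes>\<^bsub>G Mod V (Suc t)\<^esub> (V (Suc t) #> v)
    = (V (Suc t) #> v) \<otimes>\<^bsub>G Mod V (Suc t)\<^esub> (V (Suc t) #> g)"
  using normal.commutator_mem_iff[OF normal_V assms(1) V_in_carrier[OF assms(2)], of "Suc t"]
    commutator_V[OF assms] by blast

end

text \<open>
  If \<open>g\<close> and \<open>u\<close> move \<open>z\<close> by factors \<open>v\<close> and \<open>w\<close> that commute with all that they have to pass, then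
  the order in which they are applied does not matter. This is the computation behind the three
  subgroups lemma.
\<close>

lemma (in monoid) commutes_with_two_shifts:
  assumes [simp]: "g \<in> carrier G" "u \<in> carrier G" "z \<in> carrier G" "v \<in> carrier G" "w \<in> carrier G"
    and gz: "g \<otimes> z = v \<otimes> (z \<otimes> g)" and uz: "u \<otimes> z = w \<otimes> (z \<otimes> u)"
    and uv: "u \<otimes> v = v \<otimes> u" and gw: "g \<otimes> w = w \<otimes> g" and vw: "v \<otimes> w = w \<otimes> v"
  shows "(g \<otimes> u) \<otimes> z = (w \<otimes> v \<otimes> z) \<otimes> (g \<otimes> u)" "(u \<otimes> g) \<otimes> z = (w \<otimes> v \<otimes> z) \<otimes> (u \<otimes> g)"
proof -
  have "(g \<otimes> u) \<otimes> z = (g \<otimes> w) \<otimes> (z \<otimes> u)" by (simp add: uz m_assoc)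
  also have "\<dots> = w \<otimes> (g \<otimes> z) \<otimes> u" unfolding gw by (simp add: m_assoc)
  also have "\<dots> = (w \<otimes> v \<otimes> z) \<otimes> (g \<otimes> u)" unfolding gz by (simp add: m_assoc)
  finally show "(g \<otimes> u) \<otimes> z = (w \<otimes> v \<otimes> z) \<otimes> (g \<otimes> u)" .
  have "(u \<otimes> g) \<otimes> z = (u \<otimes> v) \<otimes> (z \<otimes> g)" by (simp add: gz m_assoc)
  also have "\<dots> = v \<otimes> (u \<otimes> z) \<otimes> g" unfolding uv by (simp add: m_assoc)
  also have "\<dots> = (v \<otimes> w) \<otimes> z \<otimes> (u \<otimes> g)" unfolding uz by (simp add: m_assoc)
  finally show "(u \<otimes> g) \<otimes> z = (w \<otimes> v \<otimes> z) \<otimes> (u \<otimes> g)" unfolding vw .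
qed

context central_filtration
begin

text \<open>
  The three subgroups lemma for a filtration: each step up in the lower central series brings one
  further step down in \<open>V\<close>. For the induction step, the elements \<open>x\<close> that commute with \<open>V t\<close> modulo the
  target form a subgroup, so it is enough to treat \<open>x = [g, u]\<close>; there \<open>g \<otimes> u\<close> and \<open>u \<otimes> g\<close> move elements
  of \<open>V t\<close> in the same way.
\<close>

lemma commutator_lower_central_V:
  assumes "x \<in> lower_central G (Suc k)" "z \<in> V t"
  shows "commutator G x z \<in> V (t + Suc k)"
  using assms
proof (induction k arbitrary: x z t)
  case 0
  then show ?case using commutator_V[of x z t] by simp
next
  case (Suc k)
  define s where "s = t + Suc k"
  let ?Q = "G Mod V (Suc s)"
  let ?h = "\<lambda>x. V (Suc s) #> x"
  interpret N: normal "V (Suc s)" G by (rule normal_V)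
  interpret h: group_hom G ?Q ?h by (rule N.coset_hom)
  define K where "K = {x \<in> carrier G. \<forall>z \<in> V t. ?h x \<otimes>\<^bsub>?Q\<^esub> ?h z = ?h z \<otimes>\<^bsub>?Q\<^esub> ?h x}"
  have K_eq: "K = {x \<in> carrier G. ?h x \<in>
      {q \<in> carrier ?Q. \<forall>s \<in> ?h ` V t. q \<otimes>\<^bsub>?Q\<^esub> s = s \<otimes>\<^bsub>?Q\<^esub> q}}"
    unfolding K_def using h.hom_closed by (auto simp del: mult_FactGroup)
  have "?h ` V t \<subseteq> carrier ?Q" using h.hom_closed V_in_carrier by blast
  then have subK: "subgroup K G"
    unfolding K_eq by (intro h.subgroup_preimage h.H.subgroup_centralizer)
  have "commutator G g u \<in> K" if g: "g \<in> carrier G" and u: "u \<in> lower_central G (Suc k)" for g u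
  proof -
    have uc: "u \<in> carrier G" using lower_central_in_carrier[OF u] .
    have gu: "commutator G g u \<in> carrier G" using g uc by simp
    have "?h (commutator G g u) \<otimes>\<^bsub>?Q\<^esub> ?h z = ?h z \<otimes>\<^bsub>?Q\<^esub> ?h (commutator G g u)" if z: "z \<in> V t" for z
    proof -
      \<comment> \<open>Chosen so that \<open>u \<otimes> g\<close> conjugates \<open>y\<close> to \<open>z\<close>; as \<open>g \<otimes> u\<close> then does so too modulo \<open>V (Suc s)\<close>, \<open>[g, u]\<close> fixes \<open>z\<close>.\<close>
      define y where "y = inv (u \<otimes> g) \<otimes> z \<otimes> (u \<otimes> g)"
      have y: "y \<in> V t"
        using normal.inv_op_closed1[OF normal_V, of "u \<otimes> g" z t] g uc z by (simp add: y_def)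
      have zc: "z \<in> carrier G" and yc: "y \<in> carrier G" using y z V_in_carrier by auto
      define v w where "v = commutator G g y" and "w = commutator G u y"
      have v: "v \<in> V (Suc t)" and w: "w \<in> V s"
        using commutator_V[OF g y] Suc.IH[OF u y] by (simp_all add: v_def w_def s_def)
      have vc: "v \<in> carrier G" and wc: "w \<in> carrier G" using v w V_in_carrier by auto
      have c: "?h x \<in> carrier ?Q" if "x \<in> carrier G" for x using that by (rule h.hom_closed)
      have gy: "?h g \<otimes>\<^bsub>?Q\<^esub> ?h y = ?h v \<otimes>\<^bsub>?Q\<^esub> (?h y \<otimes>\<^bsub>?Q\<^esub> ?h g)"

        using arg_cong[OF commutator_mult[OF g yc], of ?h] g yc vc
        by (simp flip: v_def del: mult_FactGroup)
      have uy: "?h u \<otimes>\<^bsub>?Q\<^esub> ?h y = ?h w \<otimes>\<^bsub>?Q\<^esub> (?h y \<otimes>\<^bsub>?Q\<^esub> ?h u)"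

        using arg_cong[OF commutator_mult[OF uc yc], of ?h] uc yc wc
        by (simp flip: w_def del: mult_FactGroup)
      have uv: "?h u \<otimes>\<^bsub>?Q\<^esub> ?h v = ?h v \<otimes>\<^bsub>?Q\<^esub> ?h u"
        using N.commutator_mem_iff[OF uc vc] Suc.IH[OF u v] by (simp add: s_def)
      have gw: "?h g \<otimes>\<^bsub>?Q\<^esub> ?h w = ?h w \<otimes>\<^bsub>?Q\<^esub> ?h g" by (rule commute_mod_V[OF g w])
      have vw: "?h v \<otimes>\<^bsub>?Q\<^esub> ?h w = ?h w \<otimes>\<^bsub>?Q\<^esub> ?h v" by (rule commute_mod_V[OF vc w])
      note shift = h.H.commutes_with_two_shifts[OF c[OF g] c[OF uc] c[OF yc] c[OF vc] c[OF wc] gy uy uv gw vw]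
      let ?z = "?h w \<otimes>\<^bsub>?Q\<^esub> ?h v \<otimes>\<^bsub>?Q\<^esub> ?h y"
      have zug: "z \<otimes> (u \<otimes> g) = (u \<otimes> g) \<otimes> y"
        using g uc zc by (simp add: y_def flip: m_assoc)
      have zug_h: "?h z \<otimes>\<^bsub>?Q\<^esub> ?h (u \<otimes> g) = ?h (u \<otimes> g) \<otimes>\<^bsub>?Q\<^esub> ?h y"
        using arg_cong[OF zug, of ?h] zc yc
        by (simp only: h.hom_mult m_closed[OF uc g])
      also have "\<dots> = ?z \<otimes>\<^bsub>?Q\<^esub> ?h (u \<otimes> g)"
        using shift(2) g uc by (simp del: mult_FactGroup)
      finally have z_eq: "?h z = ?z"
        using c g uc vc wc yc zc by (simp del: mult_FactGroup)
      have ug_gu: "?h (commutator G g u) \<otimes>\<^bsub>?Q\<^esub> ?h (u \<otimes> g) = ?h (g \<otimes> u)"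
        using arg_cong[OF commutator_mult[OF g uc], of ?h] g uc gu by (simp del: mult_FactGroup)
      have "(?h (commutator G g u) \<otimes>\<^bsub>?Q\<^esub> ?h z) \<otimes>\<^bsub>?Q\<^esub> ?h (u \<otimes> g)
          = ?h (commutator G g u) \<otimes>\<^bsub>?Q\<^esub> (?h z \<otimes>\<^bsub>?Q\<^esub> ?h (u \<otimes> g))"
        by (rule h.H.m_assoc[OF c[OF gu] c[OF zc] c[OF m_closed[OF uc g]]])
      also have "\<dots> = (?h (commutator G g u) \<otimes>\<^bsub>?Q\<^esub> ?h (u \<otimes> g)) \<otimes>\<^bsub>?Q\<^esub> ?h y"
        unfolding zug_h by (rule h.H.m_assoc[symmetric, OF c[OF gu] c[OF m_closed[OF uc g]] c[OF yc]])
      also have "\<dots> = ?h z \<otimes>\<^bsub>?Q\<^esub> ?h (g \<otimes> u)"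
        unfolding z_eq ug_gu using shift(1) g uc by (simp del: mult_FactGroup)
      also have "\<dots> = (?h z \<otimes>\<^bsub>?Q\<^esub> ?h (commutator G g u)) \<otimes>\<^bsub>?Q\<^esub> ?h (u \<otimes> g)"
        unfolding ug_gu[symmetric]
        by (rule h.H.m_assoc[symmetric, OF c[OF zc] c[OF gu] c[OF m_closed[OF uc g]]])
      finally show ?thesis
        using c[OF gu] c[OF zc] c[of "u \<otimes> g"] g uc by (simp del: mult_FactGroup)
    qed
    then show ?thesis using gu by (simp add: K_def del: mult_FactGroup)
  qed
  then have "lower_central G (Suc (Suc k)) \<subseteq> K"
    using generate_subgroup_incl[OF _ subK, of "\<Union>g \<in> carrier G. \<Union>u \<in> lower_central G (Suc k). {commutator G g u}"]
    by fastforce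
  then have "x \<in> K" using Suc.prems by blast
  then show ?case
    using Suc.prems(2) V_in_carrier[OF Suc.prems(2)] N.commutator_mem_iff
    by (simp add: K_def s_def del: mult_FactGroup)
qed

end

text \<open>
  Truncated subtraction is harmless, since the constant continuation of the upper central series by
  the trivial group is still a central filtration.
\<close>

lemma (in group) commutator_lower_upper_central:
  assumes "z \<in> upper_central G n" "u \<in> lower_central G (Suc k)"
  shows "commutator G u z \<in> upper_central G (n - Suc k)"
proof -
  interpret F: central_filtration G "\<lambda>t. upper_central G (n - t)"
  proof (intro central_filtration.intro central_filtration_axioms.intro is_group)
    fix t show "subgroup (upper_central G (n - t)) G"
      using normal_upper_central normal_imp_subgroup by blast
    show "upper_central G (n - Suc t) \<subseteq> upper_central G (n - t)" by (rule upper_central_mono) simp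
    fix g v assume g: "g \<in> carrier G" and v: "v \<in> upper_central G (n - t)"
    show "commutator G g v \<in> upper_central G (n - Suc t)"
    proof (cases "n - t")
      case 0
      then show ?thesis using g v by (simp add: commutator_def)
    next
      case (Suc m)
      then have "n - Suc t = m" by simp
      then show ?thesis using g v unfolding Suc mem_upper_central_Suc_iff by simp
    qed
  qed
  show ?thesis using F.commutator_lower_central_V[OF assms(2), of z 0] assms(1) by simp
qed

section \<open>Iterated commutators\<close>

lemma iter_commutator_Cons:
  "gs \<noteq> [] \<Longrightarrow> iter_commutator G (g # gs) = commutator G g (iter_commutator G gs)"
  by (cases gs) simp_all

lemma (in group) iter_commutator_lower_central:
  "set gs \<subseteq> carrier G \<Longrightarrow> length gs = Suc k \<Longrightarrow> iter_commutator G gs \<in> lower_central G (Suc k)"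
proof (induction k arbitrary: gs)
  case 0
  then obtain g where "gs = [g]" by (auto simp: length_Suc_conv)
  then show ?case using 0 by simp
next
  case (Suc k)
  then obtain g gs' where gs: "gs = g # gs'" "length gs' = Suc k" by (auto simp: length_Suc_conv)
  then have "gs' \<noteq> []" by auto
  then show ?case using Suc gs lower_central_commutator[of g "iter_commutator G gs'" k]
    by (simp add: iter_commutator_Cons del: lower_central.simps)
qed

lemma (in group_hom) hom_iter_commutator:
  "set gs \<subseteq> carrier G \<Longrightarrow> h (iter_commutator G gs) = iter_commutator H (map h gs)"
proof (induction gs)
  case (Cons g gs)
  show ?case
  proof (cases "gs = []")
    case False
    have "length gs = Suc (length gs - 1)" using False by simp
    then have "iter_commutator G gs \<in> carrier G"
      using G.iter_commutator_lower_central[of gs "length gs - 1"] Cons.prems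
        G.lower_central_in_carrier by auto
    then show ?thesis using Cons False by (simp add: iter_commutator_Cons hom_commutator)
  qed simp
qed simp

text \<open>
  A commutator of weight \<open>n + 1\<close> depends only on the classes of its entries modulo the \<open>n\<close>-th centre.
  For the induction this has to be refined: with fewer entries it is determined modulo a smaller
  centre only. A factor in \<open>Z\<^sub>n\<close> of the entry in front of a commutator of weight \<open>k\<close> can be dropped modulo
  \<open>Z\<^sub>n\<^sub>-\<^sub>k\<close> by \<open>commutator_lower_upper_central\<close>.
\<close>

lemma (in group) iter_commutator_cong_mod_upper_central:
  assumes "length gs = Suc k" "length hs = Suc k" "set gs \<subseteq> carrier G" "set hs \<subseteq> carrier G"
    and "\<forall>i < Suc k. upper_central G n #> gs ! i = upper_central G n #> hs ! i"
  shows "upper_central G (n - k) #> iter_commutator G gs = upper_central G (n - k) #> iter_commutator G hs"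
  using assms
proof (induction k arbitrary: gs hs)
  case 0
  then obtain g h where "gs = [g]" "hs = [h]" by (auto simp: length_Suc_conv)
  then show ?case using 0 by simp
next
  case (Suc k)
  obtain g gs' where gs: "gs = g # gs'" "length gs' = Suc k"
    using Suc.prems(1) by (auto simp: length_Suc_conv)
  obtain h hs' where hs: "hs = h # hs'" "length hs' = Suc k"
    using Suc.prems(2) by (auto simp: length_Suc_conv)
  define u w where "u = iter_commutator G gs'" and "w = iter_commutator G hs'"
  have ne: "gs' \<noteq> []" "hs' \<noteq> []" using gs hs by auto
  have c: "g \<in> carrier G" "h \<in> carrier G" and gs': "set gs' \<subseteq> carrier G" and hs': "set hs' \<subseteq> carrier G"
    using Suc.prems gs hs by auto
  have ul: "u \<in> lower_central G (Suc k)" and wl: "w \<in> lower_central G (Suc k)"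
    unfolding u_def w_def by (rule iter_commutator_lower_central[OF gs' gs(2)] iter_commutator_lower_central[OF hs' hs(2)])+
  have uc: "u \<in> carrier G" and wc: "w \<in> carrier G" using lower_central_in_carrier[OF ul] lower_central_in_carrier[OF wl] by simp_all
  have gh: "upper_central G n #> g = upper_central G n #> h" using spec[OF Suc.prems(5), of 0] gs(1) hs(1) by simp
  have "\<forall>i < Suc k. upper_central G n #> gs' ! i = upper_central G n #> hs' ! i"
  proof (intro allI impI)
    fix i assume "i < Suc k"
    then show "upper_central G n #> gs' ! i = upper_central G n #> hs' ! i"
      using spec[OF Suc.prems(5), of "Suc i"] gs(1) hs(1) by simp
  qed
  then have uw: "upper_central G (n - k) #> u = upper_central G (n - k) #> w"
    unfolding u_def w_def by (rule Suc.IH[OF gs(2) hs(2) gs' hs'])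
  let ?Z = "upper_central G (n - Suc k)"
  interpret N: normal ?Z G by (rule normal_upper_central)
  interpret h: group_hom G "G Mod ?Z" "\<lambda>x. ?Z #> x" by (rule N.coset_hom)
  have coset_multiple: "\<exists>z \<in> N. x = z \<otimes> y"
    if "N \<lhd> G" "x \<in> carrier G" "y \<in> carrier G" "N #> x = N #> y" for N x y
    using rcos_self[OF that(2) normal_imp_subgroup[OF that(1)]] that(4) by (auto simp: r_coset_def)
  obtain z where z: "z \<in> upper_central G n" "g = z \<otimes> h"
    using coset_multiple[OF normal_upper_central c gh] by (elim bexE)
  obtain y where y: "y \<in> upper_central G (n - k)" "u = y \<otimes> w"
    using coset_multiple[OF normal_upper_central uc wc uw] by (elim bexE)
  have zc: "z \<in> carrier G" and yc: "y \<in> carrier G"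
    using upper_central_in_carrier z(1) y(1) by simp_all
  have commute: "(?Z #> a) \<otimes>\<^bsub>G Mod ?Z\<^esub> (?Z #> b) = (?Z #> b) \<otimes>\<^bsub>G Mod ?Z\<^esub> (?Z #> a)"
    if "a \<in> lower_central G (Suc l)" "b \<in> upper_central G m" "m - Suc l \<le> n - Suc k" for a b l m
  proof -
    have "a \<in> carrier G" "b \<in> carrier G"
      using lower_central_in_carrier[OF that(1)] upper_central_in_carrier[OF that(2)] by simp_all
    moreover have "commutator G a b \<in> ?Z"
      using commutator_lower_upper_central[OF that(2,1)] upper_central_mono[OF that(3)] by blast
    ultimately show ?thesis using N.commutator_mem_iff by blast
  qed
  have "?Z #> commutator G (z \<otimes> h) u = ?Z #> commutator G h u"
  proof -
    have hu: "commutator G h u \<in> lower_central G (Suc (Suc k))"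
      by (rule lower_central_commutator[OF c(2) ul])
    have "commutator (G Mod ?Z) ((?Z #> z) \<otimes>\<^bsub>G Mod ?Z\<^esub> (?Z #> h)) (?Z #> u) = commutator (G Mod ?Z) (?Z #> h) (?Z #> u)"
      using commute[OF ul z(1)] commute[OF hu z(1)] zc c uc
      by (intro h.H.commutator_absorb_left h.hom_closed) (simp_all only: h.hom_commutator diff_le_mono2 le_refl le_SucI)
    then show ?thesis using zc c uc by (simp only: h.hom_commutator h.hom_mult m_closed)
  qed
  moreover have "?Z #> commutator G h (y \<otimes> w) = ?Z #> commutator G h w"
  proof -
    have hw: "commutator G h w \<in> lower_central G (Suc (Suc k))"
      by (rule lower_central_commutator[OF c(2) wl])
    have h1: "h \<in> lower_central G (Suc 0)" using c by simp
    have le: "n - k - Suc 0 \<le> n - Suc k" "n - k - Suc (Suc k) \<le> n - Suc k" by simp_all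
    have "commutator (G Mod ?Z) (?Z #> h) ((?Z #> y) \<otimes>\<^bsub>G Mod ?Z\<^esub> (?Z #> w)) = commutator (G Mod ?Z) (?Z #> h) (?Z #> w)"
      using commute[OF h1 y(1) le(1)] commute[OF hw y(1) le(2)] yc c wc
      by (intro h.H.commutator_absorb_right h.hom_closed) (simp_all only: h.hom_commutator)
    then show ?thesis using yc c wc by (simp only: h.hom_commutator h.hom_mult m_closed)
  qed
  ultimately have "?Z #> commutator G g u = ?Z #> commutator G h w" using z(2) y(2) by simp
  then show ?case using ne gs(1) hs(1) by (simp add: iter_commutator_Cons u_def w_def)
qed

section \<open>Isoclinism of groups\<close>

lemma (in group) group_quot_upper_central: "group (G Mod upper_central G n)"
  by (rule normal.factorgroup_is_group[OF normal_upper_central])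

lemma (in group) group_lower_central: "group (G\<lparr>carrier := lower_central G n\<rparr>)"
  by (rule subgroup.subgroup_is_group[OF subgroup_lower_central is_group])

lemma tuples_set: "gs \<in> tuples S k \<Longrightarrow> set gs \<subseteq> S"
  and tuples_length: "gs \<in> tuples S k \<Longrightarrow> length gs = k"
  by (simp_all add: tuples_def)

lemma tuples_nth: "gs \<in> tuples S k \<Longrightarrow> i < k \<Longrightarrow> gs ! i \<in> S"
  by (auto simp: tuples_def)

lemma (in group) upper_central_coset_carrier:
  "g \<in> carrier G \<Longrightarrow> upper_central G n #> g \<in> carrier (G Mod upper_central G n)"
  by (simp add: carrier_FactGroup)

lemma group_isoclinic_sym:
  assumes "group G" "group H" "group_isoclinic n G H"
  shows "group_isoclinic n H G"
proof -
  interpret G: group G by fact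
  interpret H: group H by fact
  let ?GZ = "G Mod upper_central G n" and ?HZ = "H Mod upper_central H n"
  let ?Gl = "G\<lparr>carrier := lower_central G (n + 1)\<rparr>" and ?Hl = "H\<lparr>carrier := lower_central H (n + 1)\<rparr>"
  obtain \<alpha> \<beta> where \<alpha>: "\<alpha> \<in> iso ?GZ ?HZ" and \<beta>: "\<beta> \<in> iso ?Gl ?Hl"
    and compat: "\<And>gs hs. \<lbrakk>gs \<in> tuples (carrier G) (n + 1); hs \<in> tuples (carrier H) (n + 1);
       \<forall>i < n + 1. \<alpha> (upper_central G n #>\<^bsub>G\<^esub> (gs ! i)) = upper_central H n #>\<^bsub>H\<^esub> (hs ! i)\<rbrakk>
       \<Longrightarrow> \<beta> (iter_commutator G gs) = iter_commutator H hs"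
    using assms(3) unfolding group_isoclinic_def by blast
  have \<alpha>_inj: "inj_on \<alpha> (carrier ?GZ)" and \<alpha>_surj: "\<alpha> ` carrier ?GZ = carrier ?HZ"
    and \<beta>_inj: "inj_on \<beta> (lower_central G (n + 1))"
    using \<alpha> \<beta> by (auto simp: iso_def bij_betw_def)
  let ?\<alpha>' = "inv_into (carrier ?GZ) \<alpha>" and ?\<beta>' = "inv_into (carrier ?Gl) \<beta>"
  have "?\<beta>' (iter_commutator H hs) = iter_commutator G gs"
    if hs: "hs \<in> tuples (carrier H) (n + 1)" and gs: "gs \<in> tuples (carrier G) (n + 1)"
      and rel: "\<forall>i < n + 1. ?\<alpha>' (upper_central H n #>\<^bsub>H\<^esub> (hs ! i)) = upper_central G n #>\<^bsub>G\<^esub> (gs ! i)"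
    for gs hs
  proof -
    have "\<alpha> (upper_central G n #>\<^bsub>G\<^esub> (gs ! i)) = upper_central H n #>\<^bsub>H\<^esub> (hs ! i)" if i: "i < n + 1" for i
    proof -
      have "upper_central H n #>\<^bsub>H\<^esub> (hs ! i) \<in> \<alpha> ` carrier ?GZ"
        unfolding \<alpha>_surj using H.upper_central_coset_carrier tuples_nth[OF hs i] .
      from f_inv_into_f[OF this] show ?thesis using rel i by simp
    qed
    then have "\<beta> (iter_commutator G gs) = iter_commutator H hs" using compat[OF gs hs] by blast
    moreover have "iter_commutator G gs \<in> lower_central G (n + 1)"
      using G.iter_commutator_lower_central[of gs n] tuples_set[OF gs] tuples_length[OF gs] by simp
    ultimately show ?thesis using inv_into_f_f[OF \<beta>_inj] by fastforce
  qed
  moreover have "?\<alpha>' \<in> iso ?HZ ?GZ" by (rule group.iso_set_sym[OF G.group_quot_upper_central \<alpha>])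
  moreover have "?\<beta>' \<in> iso ?Hl ?Gl" by (rule group.iso_set_sym[OF G.group_lower_central \<beta>])
  ultimately show ?thesis unfolding group_isoclinic_def by blast
qed

text \<open>
  The entries of a commutator in \<open>K\<close> are related to those in \<open>G\<close> only through cosets, so
  representatives in \<open>H\<close> of the intermediate cosets have to be chosen.
\<close>

lemma group_isoclinic_trans:
  assumes "group G" "group H" "group K" and GH: "group_isoclinic n G H" and HK: "group_isoclinic n H K"
  shows "group_isoclinic n G K"
proof -
  interpret G: group G by fact
  interpret H: group H by fact
  interpret K: group K by fact
  let ?GZ = "G Mod upper_central G n" and ?HZ = "H Mod upper_central H n" and ?KZ = "K Mod upper_central K n"
  let ?Gl = "G\<lparr>carrier := lower_central G (n + 1)\<rparr>" and ?Hl = "H\<lparr>carrier := lower_central H (n + 1)\<rparr>"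
    and ?Kl = "K\<lparr>carrier := lower_central K (n + 1)\<rparr>"
  obtain \<alpha> \<beta> where \<alpha>: "\<alpha> \<in> iso ?GZ ?HZ" and \<beta>: "\<beta> \<in> iso ?Gl ?Hl"
    and compat: "\<And>gs hs. \<lbrakk>gs \<in> tuples (carrier G) (n + 1); hs \<in> tuples (carrier H) (n + 1);
       \<forall>i < n + 1. \<alpha> (upper_central G n #>\<^bsub>G\<^esub> (gs ! i)) = upper_central H n #>\<^bsub>H\<^esub> (hs ! i)\<rbrakk>
       \<Longrightarrow> \<beta> (iter_commutator G gs) = iter_commutator H hs"
    using GH unfolding group_isoclinic_def by blast
  obtain \<alpha>' \<beta>' where \<alpha>': "\<alpha>' \<in> iso ?HZ ?KZ" and \<beta>': "\<beta>' \<in> iso ?Hl ?Kl"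
    and compat': "\<And>hs ks. \<lbrakk>hs \<in> tuples (carrier H) (n + 1); ks \<in> tuples (carrier K) (n + 1);
       \<forall>i < n + 1. \<alpha>' (upper_central H n #>\<^bsub>H\<^esub> (hs ! i)) = upper_central K n #>\<^bsub>K\<^esub> (ks ! i)\<rbrakk>
       \<Longrightarrow> \<beta>' (iter_commutator H hs) = iter_commutator K ks"
    using HK unfolding group_isoclinic_def by blast
  have "(\<beta>' \<circ> \<beta>) (iter_commutator G gs) = iter_commutator K ks"
    if gs: "gs \<in> tuples (carrier G) (n + 1)" and ks: "ks \<in> tuples (carrier K) (n + 1)"
      and rel: "\<forall>i < n + 1. (\<alpha>' \<circ> \<alpha>) (upper_central G n #>\<^bsub>G\<^esub> (gs ! i)) = upper_central K n #>\<^bsub>K\<^esub> (ks ! i)"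
    for gs ks
  proof -
    have "\<exists>h \<in> carrier H. \<alpha> (upper_central G n #>\<^bsub>G\<^esub> g) = upper_central H n #>\<^bsub>H\<^esub> h"
      if "g \<in> carrier G" for g
    proof -
      have "\<alpha> (upper_central G n #>\<^bsub>G\<^esub> g) \<in> carrier ?HZ"
        using \<alpha> G.upper_central_coset_carrier[OF that] by (auto simp: iso_def bij_betw_def)
      then show ?thesis by (auto simp: carrier_FactGroup)
    qed
    then obtain c where c: "\<And>g. g \<in> carrier G \<Longrightarrow> c g \<in> carrier H"
      and \<alpha>c: "\<And>g. g \<in> carrier G \<Longrightarrow> \<alpha> (upper_central G n #>\<^bsub>G\<^esub> g) = upper_central H n #>\<^bsub>H\<^esub> (c g)"
      by metis
    have hs: "map c gs \<in> tuples (carrier H) (n + 1)"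
      using gs c by (auto simp: tuples_def)
    have "\<beta> (iter_commutator G gs) = iter_commutator H (map c gs)"
      using compat[OF gs hs] tuples_nth[OF gs] tuples_length[OF gs] \<alpha>c by simp
    moreover have "\<beta>' (iter_commutator H (map c gs)) = iter_commutator K ks"
      using compat'[OF hs ks] rel tuples_nth[OF gs] tuples_length[OF gs] \<alpha>c by simp
    ultimately show ?thesis by simp
  qed
  moreover have "\<alpha>' \<circ> \<alpha> \<in> iso ?GZ ?KZ" by (rule iso_set_trans[OF \<alpha> \<alpha>'])
  moreover have "\<beta>' \<circ> \<beta> \<in> iso ?Gl ?Kl" by (rule iso_set_trans[OF \<beta> \<beta>'])
  ultimately show ?thesis unfolding group_isoclinic_def by blast
qed

text \<open>
  Descending induction along both central series at once: an element of weight \<open>m + 1\<close> is tested in the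
  \<open>j\<close>-th centre by commutators of weight \<open>m + 2\<close> in the \<open>(j - 1)\<close>-st, until weight \<open>n + 1\<close> is reached, where
  injectivity decides.
\<close>

lemma (in group_hom) mem_upper_central_iff_of_inj_on:
  assumes surj: "h ` carrier G = carrier H" and inj: "inj_on h (lower_central G (Suc n))"
    and "g \<in> lower_central G (Suc m)" "m + j = n"
  shows "g \<in> upper_central G j \<longleftrightarrow> h g \<in> upper_central H j"
  using assms(3,4)
proof (induction j arbitrary: m g)
  case 0
  then have g: "g \<in> lower_central G (Suc n)" by simp
  have one: "\<one> \<in> lower_central G (Suc n)" by (rule subgroup.one_closed[OF G.subgroup_lower_central])
  have "g = \<one> \<longleftrightarrow> h g = \<one>\<^bsub>H\<^esub>" using inj_on_eq_iff[OF inj g one] by simp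
  then show ?case by simp
next
  case (Suc j)
  have gc: "g \<in> carrier G" by (rule G.lower_central_in_carrier[OF Suc.prems(1)])
  have step: "commutator G x g \<in> upper_central G j \<longleftrightarrow> commutator H (h x) (h g) \<in> upper_central H j"
    if x: "x \<in> carrier G" for x
    using Suc.IH[OF G.lower_central_commutator[OF x Suc.prems(1)]] Suc.prems(2) hom_commutator[OF x gc]
    by simp
  have "g \<in> upper_central G (Suc j) \<longleftrightarrow> (\<forall>x \<in> carrier G. commutator H (h x) (h g) \<in> upper_central H j)"
    unfolding G.mem_upper_central_Suc_iff using step gc by blast
  also have "\<dots> \<longleftrightarrow> h g \<in> upper_central H (Suc j)"
    unfolding H.mem_upper_central_Suc_iff surj[symmetric] using gc by auto
  finally show ?case .
qed

text \<open>
  The criterion by which all isoclinisms of this development are obtained. The upper isomorphism is the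
  map of quotients by the \<open>n\<close>-th centres, the lower one is \<open>h\<close> itself.
\<close>

lemma (in group_hom) group_isoclinic_of_surj:
  assumes surj: "h ` carrier G = carrier H" and inj: "inj_on h (lower_central G (Suc n))"
  shows "group_isoclinic n G H"
proof -
  let ?GZ = "G Mod upper_central G n" and ?HZ = "H Mod upper_central H n"
  let ?Gl = "G\<lparr>carrier := lower_central G (n + 1)\<rparr>" and ?Hl = "H\<lparr>carrier := lower_central H (n + 1)\<rparr>"
  interpret N: normal "upper_central H n" H by (rule H.normal_upper_central)
  interpret q: group_hom H ?HZ "\<lambda>x. upper_central H n #>\<^bsub>H\<^esub> x" by (rule N.coset_hom)
  let ?\<phi> = "\<lambda>x. upper_central H n #>\<^bsub>H\<^esub> h x"
  have "?\<phi> \<in> hom G ?HZ"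
    using Group.hom_compose[OF homh q.homh] by (simp add: comp_def)
  then interpret \<phi>: group_hom G ?HZ ?\<phi>
    by (simp add: group_hom_def group_hom_axioms_def G.is_group q.H.is_group)
  have mem: "g \<in> upper_central G n \<longleftrightarrow> h g \<in> upper_central H n" if "g \<in> carrier G" for g
    using mem_upper_central_iff_of_inj_on[OF surj inj, of g 0 n] that by simp
  have ker: "kernel G ?HZ ?\<phi> = upper_central G n"
  proof (rule Set.set_eqI)
    fix g show "g \<in> kernel G ?HZ ?\<phi> \<longleftrightarrow> g \<in> upper_central G n"
      using mem[of g] G.upper_central_in_carrier[of g n] N.coset_eq_self_iff[of "h g"]
      by (cases "g \<in> carrier G") (auto simp: kernel_def)
  qed
  have "?\<phi> ` carrier G = (\<lambda>x. upper_central H n #>\<^bsub>H\<^esub> x) ` h ` carrier G" by (simp add: image_image)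
  then have \<phi>_surj: "?\<phi> ` carrier G = carrier ?HZ" unfolding surj by (simp add: carrier_FactGroup)
  define \<alpha> where "\<alpha> = (\<lambda>U. the_elem (?\<phi> ` U))"
  have \<alpha>: "\<alpha> \<in> iso ?GZ ?HZ"
    using \<phi>.FactGroup_iso_set[OF \<phi>_surj] unfolding ker \<alpha>_def .
  have \<alpha>_coset: "\<alpha> (upper_central G n #>\<^bsub>G\<^esub> g) = ?\<phi> g" if g: "g \<in> carrier G" for g
  proof -
    have "?\<phi> x = ?\<phi> g" if x: "x \<in> upper_central G n #>\<^bsub>G\<^esub> g" for x
    proof -
      obtain z where z: "z \<in> upper_central G n" "x = z \<otimes> g" using x by (auto simp: r_coset_def)
      then have "z \<in> carrier G" "?\<phi> z = \<one>\<^bsub>?HZ\<^esub>" using ker by (auto simp: kernel_def)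
      then show ?thesis unfolding z(2) \<phi>.hom_mult[OF \<open>z \<in> carrier G\<close> g]
        using q.H.l_one[OF \<phi>.hom_closed[OF g]] by simp
    qed
    moreover have "g \<in> upper_central G n #>\<^bsub>G\<^esub> g"
      by (rule G.rcos_self[OF g normal_imp_subgroup[OF G.normal_upper_central]])
    ultimately have "?\<phi> ` (upper_central G n #>\<^bsub>G\<^esub> g) = {?\<phi> g}" by blast
    then show ?thesis by (simp add: \<alpha>_def)
  qed
  have h_lower: "h ` lower_central G (n + 1) = lower_central H (n + 1)" by (rule lower_central_image[OF surj])
  have "h \<in> hom ?Gl ?Hl"
  proof (rule homI)
    fix x y assume xy: "x \<in> carrier ?Gl" "y \<in> carrier ?Gl"
    then show "h x \<in> carrier ?Hl" using h_lower by auto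
    have "x \<in> carrier G" "y \<in> carrier G" using xy G.lower_central_in_carrier by auto
    then show "h (x \<otimes>\<^bsub>?Gl\<^esub> y) = h x \<otimes>\<^bsub>?Hl\<^esub> h y" by simp
  qed
  then have \<beta>: "h \<in> iso ?Gl ?Hl" using h_lower inj by (simp add: iso_def bij_betw_def)
  have "h (iter_commutator G gs) = iter_commutator H hs"
    if gs: "gs \<in> tuples (carrier G) (n + 1)" and hs: "hs \<in> tuples (carrier H) (n + 1)"
      and rel: "\<forall>i < n + 1. \<alpha> (upper_central G n #>\<^bsub>G\<^esub> (gs ! i)) = upper_central H n #>\<^bsub>H\<^esub> (hs ! i)"
    for gs hs
  proof -
    have len: "length (map h gs) = Suc n" "length hs = Suc n"
      using tuples_length[OF gs] tuples_length[OF hs] by simp_all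
    have sub: "set (map h gs) \<subseteq> carrier H" "set hs \<subseteq> carrier H"
      using tuples_set[OF gs] tuples_set[OF hs] by auto
    have "\<forall>i < Suc n. upper_central H n #>\<^bsub>H\<^esub> map h gs ! i = upper_central H n #>\<^bsub>H\<^esub> hs ! i"
      using rel \<alpha>_coset tuples_nth[OF gs] tuples_length[OF gs] by simp
    \<comment> \<open>With \<open>n + 1\<close> entries the congruence is modulo the trivial group, that is, an equality.\<close>
    from H.iter_commutator_cong_mod_upper_central[OF len sub this]
    have "{\<one>\<^bsub>H\<^esub>} #>\<^bsub>H\<^esub> iter_commutator H (map h gs) = {\<one>\<^bsub>H\<^esub>} #>\<^bsub>H\<^esub> iter_commutator H hs" by simp
    moreover have "iter_commutator H (map h gs) \<in> carrier H" "iter_commutator H hs \<in> carrier H"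
      using H.iter_commutator_lower_central[OF sub(1) len(1)] H.iter_commutator_lower_central[OF sub(2) len(2)]
        H.lower_central_in_carrier by blast+
    ultimately show ?thesis using hom_iter_commutator[OF tuples_set[OF gs]] by (simp add: r_coset_def)
  qed
  then show ?thesis unfolding group_isoclinic_def using \<alpha> \<beta> by blast
qed

section \<open>The operations of a skew brace\<close>

lemma carrier_circ_group [simp]: "carrier (circ_group A) = carrier A"
  and mult_circ_group [simp]: "monoid.mult (circ_group A) = circ A"
  and one_circ_group [simp]: "one (circ_group A) = one A"
  by (simp_all add: circ_group_def)

context skew_brace
begin

sublocale C: group "circ_group A" by (rule circ_group)

lemma circ_closed [simp]: "\<lbrakk>a \<in> carrier A; b \<in> carrier A\<rbrakk> \<Longrightarrow> a \<diamondop> b \<in> carrier A"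
  using C.m_closed by simp

lemma circ_assoc:
  "\<lbrakk>a \<in> carrier A; b \<in> carrier A; c \<in> carrier A\<rbrakk> \<Longrightarrow> a \<diamondop> b \<diamondop> c = a \<diamondop> (b \<diamondop> c)"
  using C.m_assoc by simp

lemma circ_one [simp]: "a \<in> carrier A \<Longrightarrow> a \<diamondop> \<one> = a" "a \<in> carrier A \<Longrightarrow> \<one> \<diamondop> a = a"
  using C.r_one C.l_one by simp_all

lemma circ_inv_closed [simp]: "a \<in> carrier A \<Longrightarrow> inv\<^bsub>circ_group A\<^esub> a \<in> carrier A"
  using C.inv_closed by simp

lemma circ_inv [simp]:
  "a \<in> carrier A \<Longrightarrow> a \<diamondop> inv\<^bsub>circ_group A\<^esub> a = \<one>" "a \<in> carrier A \<Longrightarrow> inv\<^bsub>circ_group A\<^esub> a \<diamondop> a = \<one>"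
  using C.r_inv[of a] C.l_inv[of a] by simp_all

lemma lambda_closed [simp]: "\<lbrakk>a \<in> carrier A; x \<in> carrier A\<rbrakk> \<Longrightarrow> lambda A a x \<in> carrier A"
  by (simp add: lambda_def)

lemma star_closed [simp]: "\<lbrakk>a \<in> carrier A; x \<in> carrier A\<rbrakk> \<Longrightarrow> star A a x \<in> carrier A"
  by (simp add: star_def)

lemma lambda_op_eq: "\<lbrakk>a \<in> carrier A; x \<in> carrier A\<rbrakk> \<Longrightarrow> lambda_op A a x = (a \<diamondop> x) \<otimes> inv a"
  by (simp add: lambda_op_def lambda_def flip: m_assoc)

lemma lambda_op_closed [simp]: "\<lbrakk>a \<in> carrier A; x \<in> carrier A\<rbrakk> \<Longrightarrow> lambda_op A a x \<in> carrier A"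
  by (simp add: lambda_op_eq)

lemma circ_eq: "\<lbrakk>a \<in> carrier A; x \<in> carrier A\<rbrakk> \<Longrightarrow> a \<diamondop> x = lambda_op A a x \<otimes> a"
  by (simp add: lambda_op_eq m_assoc)

lemma lambda_op_mult:
  "\<lbrakk>a \<in> carrier A; x \<in> carrier A; y \<in> carrier A\<rbrakk>
    \<Longrightarrow> lambda_op A a (x \<otimes> y) = lambda_op A a x \<otimes> lambda_op A a y"
  by (simp add: lambda_op_eq brace_law m_assoc)

lemma lambda_op_hom: "a \<in> carrier A \<Longrightarrow> group_hom A A (lambda_op A a)"
  by (simp add: group_hom_def group_hom_axioms_def hom_def lambda_op_mult is_group Pi_def)

lemma lambda_op_one: "a \<in> carrier A \<Longrightarrow> lambda_op A a \<one> = \<one>"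
  using group_hom.hom_one[OF lambda_op_hom] .

lemma lambda_op_inv:
  "\<lbrakk>a \<in> carrier A; x \<in> carrier A\<rbrakk> \<Longrightarrow> lambda_op A a (inv x) = inv (lambda_op A a x)"
  using group_hom.hom_inv[OF lambda_op_hom] .

lemma lambda_op_one_left [simp]: "x \<in> carrier A \<Longrightarrow> lambda_op A \<one> x = x"
  by (simp add: lambda_op_eq)

lemma lambda_op_circ:
  assumes [simp]: "a \<in> carrier A" "b \<in> carrier A" "x \<in> carrier A"
  shows "lambda_op A (a \<diamondop> b) x = lambda_op A a (lambda_op A b x)"
proof -
  have "lambda_op A a (lambda_op A b x) = lambda_op A a (b \<diamondop> x) \<otimes> inv (lambda_op A a b)"
    by (simp add: lambda_op_eq[of b] lambda_op_mult lambda_op_inv)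
  also have "\<dots> = lambda_op A (a \<diamondop> b) x"
    by (simp add: lambda_op_eq circ_assoc inv_mult_group m_assoc)
  finally show ?thesis ..
qed

text \<open>
  The displacement of \<open>x\<close> under \<open>\<lambda>\<^sup>o\<^sup>p\<^sub>a\<close> is made of two basic commutators with \<open>x\<close> in the second place.
  This links the action defining \<open>\<Lambda>\<^sub>A\<close> to commutator words.
\<close>

lemma lambda_op_mult_inv:
  "\<lbrakk>a \<in> carrier A; x \<in> carrier A\<rbrakk>
    \<Longrightarrow> lambda_op A a x \<otimes> inv x = (a \<otimes> star A a x \<otimes> inv a) \<otimes> commutator A a x"
  by (simp add: lambda_op_def star_def commutator_def m_assoc)

lemma star_eq_one_iff:
  "\<lbrakk>a \<in> carrier A; b \<in> carrier A\<rbrakk> \<Longrightarrow> star A a b = \<one> \<longleftrightarrow> a \<diamondop> b = a \<otimes> b"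
  unfolding star_def lambda_def
  using inv_solve_right[of \<one> "inv a \<otimes> (a \<diamondop> b)" b] inv_solve_left'[of b a "a \<diamondop> b"] by auto

end

section \<open>Homomorphisms, ideals and quotients\<close>

locale skew_brace_hom = A: skew_brace A + B: skew_brace B
  for A :: "('a, 'm) brace_scheme" and B :: "('b, 'k) brace_scheme" +
  fixes h :: "'a \<Rightarrow> 'b"
  assumes brace_hom: "h \<in> brace_hom A B"
begin

sublocale group_hom A B h
  using brace_hom by (simp add: group_hom_def group_hom_axioms_def brace_hom_def A.is_group B.is_group)

sublocale C: group_hom "circ_group A" "circ_group B" h
  using brace_hom
  by (simp add: group_hom_def group_hom_axioms_def brace_hom_def A.circ_group B.circ_group)

lemma hom_circ [simp]:
  "\<lbrakk>a \<in> carrier A; b \<in> carrier A\<rbrakk> \<Longrightarrow> h (a \<diamondop>\<^bsub>A\<^esub> b) = h a \<diamondop>\<^bsub>B\<^esub> h b"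
  using C.hom_mult by simp

lemma hom_star: "\<lbrakk>a \<in> carrier A; b \<in> carrier A\<rbrakk> \<Longrightarrow> h (star A a b) = star B (h a) (h b)"
  by (simp add: star_def lambda_def)

lemma hom_lambda_op:
  "\<lbrakk>a \<in> carrier A; b \<in> carrier A\<rbrakk> \<Longrightarrow> h (lambda_op A a b) = lambda_op B (h a) (h b)"
  by (simp add: lambda_op_def lambda_def)

end

lemma skew_brace_hom_comp:
  assumes "skew_brace_hom A B f" "skew_brace_hom B C g"
  shows "skew_brace_hom A C (g \<circ> f)"
proof -
  interpret f: skew_brace_hom A B f by fact
  interpret g: skew_brace_hom B C g by fact
  show ?thesis
    by (intro skew_brace_hom.intro skew_brace_hom_axioms.intro f.A.skew_brace_axioms g.B.skew_brace_axioms)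
      (use Group.hom_compose[OF f.homh g.homh] Group.hom_compose[OF f.C.homh g.C.homh] in
        \<open>simp add: brace_hom_def\<close>)
qed

text \<open>
  Stability under the maps \<open>\<lambda>\<^sub>a\<close> is replaced by the equality of the cosets in the two groups, to which
  it is equivalent for a subgroup normal in both. This form is immediate for kernels and is what
  the quotient construction needs.
\<close>

definition brace_ideal :: "('a, 'm) brace_scheme \<Rightarrow> 'a set \<Rightarrow> bool" where
  "brace_ideal A I \<longleftrightarrow> I \<lhd> A \<and> I \<lhd> circ_group A \<and>
     (\<forall>a \<in> carrier A. I #>\<^bsub>A\<^esub> a = I #>\<^bsub>circ_group A\<^esub> a)"

lemma (in group_hom) kernel_coset:
  assumes "a \<in> carrier G"
  shows "kernel G H h #> a = {x \<in> carrier G. h x = h a}"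
proof
  show "kernel G H h #> a \<subseteq> {x \<in> carrier G. h x = h a}"
    using assms by (auto simp: r_coset_def kernel_def)
  show "{x \<in> carrier G. h x = h a} \<subseteq> kernel G H h #> a"
  proof
    fix x assume x: "x \<in> {x \<in> carrier G. h x = h a}"
    then have "x \<otimes> inv a \<in> kernel G H h" using assms by (simp add: kernel_def)
    moreover have "x = (x \<otimes> inv a) \<otimes> a" using x assms by (simp add: G.m_assoc)
    ultimately show "x \<in> kernel G H h #> a" unfolding r_coset_def by blast
  qed
qed

lemma (in skew_brace_hom) brace_ideal_kernel: "brace_ideal A (kernel A B h)"
proof -
  have "kernel (circ_group A) (circ_group B) h = kernel A B h" by (simp add: kernel_def)
  then show ?thesis
    unfolding brace_ideal_def using normal_kernel C.normal_kernel kernel_coset C.kernel_coset by simp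
qed

lemma (in skew_brace) brace_quot_hom:
  assumes "brace_ideal A I"
  shows "skew_brace_hom A (brace_quot A I) (\<lambda>a. I #> a)"
proof -
  interpret N: normal I A using assms by (simp add: brace_ideal_def)
  interpret CN: normal I "circ_group A" using assms by (simp add: brace_ideal_def)
  have coset: "I #>\<^bsub>circ_group A\<^esub> a = I #> a" if "a \<in> carrier A" for a
    using assms that by (simp add: brace_ideal_def)
  then have rcosets: "rcosets\<^bsub>circ_group A\<^esub> I = rcosets I" by (simp add: RCOSETS_def)
  let ?Q = "brace_quot A I"
  have carrier_Q: "carrier ?Q = (\<lambda>a. I #> a) ` carrier A" by (auto simp: brace_quot_def RCOSETS_def)
  have circ_Q: "circ_group ?Q = circ_group A Mod I"
    by (simp add: circ_group_def[of ?Q] brace_quot_def FactGroup_def rcosets)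
  have hom: "(\<lambda>a. I #> a) \<in> hom A ?Q"
    using N.r_coset_hom_Mod by (simp add: hom_def brace_quot_def FactGroup_def)
  have "(\<lambda>a. I #>\<^bsub>circ_group A\<^esub> a) \<in> hom (circ_group A) (circ_group ?Q)"
    unfolding circ_Q by (rule CN.r_coset_hom_Mod)
  then have circ_hom: "(\<lambda>a. I #> a) \<in> hom (circ_group A) (circ_group ?Q)"
    using coset by (auto simp: hom_def Pi_def)
  have "group ?Q"
    using N.factorgroup_is_group
    by (simp add: group_def monoid_def group_axioms_def Units_def brace_quot_def FactGroup_def)
  then interpret q: group_hom A ?Q "\<lambda>a. I #> a"
    using hom by (simp add: group_hom_def group_hom_axioms_def is_group)
  have circ_hom': "I #> (a \<diamondop> b) = (I #> a) \<diamondop>\<^bsub>?Q\<^esub> (I #> b)" if "a \<in> carrier A" "b \<in> carrier A" for a b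
    using circ_hom that by (simp add: hom_def)
  have "skew_brace ?Q"
  proof (intro skew_brace.intro skew_brace_axioms.intro)
    show "group (circ_group ?Q)" unfolding circ_Q by (rule CN.factorgroup_is_group)
    fix U V W assume "U \<in> carrier ?Q" "V \<in> carrier ?Q" "W \<in> carrier ?Q"
    then obtain a b c where abc: "a \<in> carrier A" "b \<in> carrier A" "c \<in> carrier A"
      and U: "U = I #> a" "V = I #> b" "W = I #> c"
      unfolding carrier_Q by blast
    have "I #> (a \<diamondop> (b \<otimes> c)) = I #> ((a \<diamondop> b) \<otimes> inv a \<otimes> (a \<diamondop> c))" using abc by (simp add: brace_law)
    then show "U \<diamondop>\<^bsub>?Q\<^esub> (V \<otimes>\<^bsub>?Q\<^esub> W) = (U \<diamondop>\<^bsub>?Q\<^esub> V) \<otimes>\<^bsub>?Q\<^esub> inv\<^bsub>?Q\<^esub> U \<otimes>\<^bsub>?Q\<^esub> (U \<diamondop>\<^bsub>?Q\<^esub> W)"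
      unfolding U using abc
      by (simp only: q.hom_mult q.hom_inv circ_hom' m_closed inv_closed circ_closed)
  qed fact
  then show ?thesis
    using hom circ_hom skew_brace_axioms
    by (simp add: skew_brace_hom_def skew_brace_hom_axioms_def brace_hom_def)
qed

text \<open>
  In this symmetric form, all four products with \<open>a\<close> agree, so closure properties become calculations in
  which any product may be replaced by any other.
\<close>

lemma (in skew_brace) mem_annihilator_iff:
  "a \<in> annihilator A \<longleftrightarrow> a \<in> carrier A \<and>
     (\<forall>b \<in> carrier A. a \<diamondop> b = a \<otimes> b \<and> b \<diamondop> a = a \<otimes> b \<and> b \<otimes> a = a \<otimes> b)"
  unfolding annihilator_def by (auto simp: star_eq_one_iff commutator_eq_one_iff)

lemma (in skew_brace) brace_ideal_annihilator: "brace_ideal A (annihilator A)"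
proof -
  let ?Z = "annihilator A"
  have c: "a \<in> carrier A" if "a \<in> ?Z" for a using that by (simp add: mem_annihilator_iff)
  have d: "a \<diamondop> b = a \<otimes> b" "b \<diamondop> a = a \<otimes> b" "b \<otimes> a = a \<otimes> b" if "a \<in> ?Z" "b \<in> carrier A" for a b
    using that by (simp_all add: mem_annihilator_iff)
  have one: "\<one> \<in> ?Z" by (simp add: mem_annihilator_iff)
  have mult: "a \<otimes> b \<in> ?Z" if a: "a \<in> ?Z" and b: "b \<in> ?Z" for a b
  proof -
    have "(a \<otimes> b) \<diamondop> x = a \<otimes> b \<otimes> x \<and> x \<diamondop> (a \<otimes> b) = a \<otimes> b \<otimes> x \<and> x \<otimes> (a \<otimes> b) = a \<otimes> b \<otimes> x"
      if x: "x \<in> carrier A" for x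
    proof (intro conjI)
      have bx: "b \<otimes> x \<in> carrier A" using c[OF b] x by simp
      have ab: "a \<otimes> b = a \<diamondop> b" using d(1)[OF a c[OF b]] by simp
      have "(a \<otimes> b) \<diamondop> x = a \<diamondop> (b \<otimes> x)" unfolding ab using circ_assoc[OF c[OF a] c[OF b] x] d(1)[OF b x] by simp
      also have "\<dots> = a \<otimes> b \<otimes> x" using d(1)[OF a bx] m_assoc[OF c[OF a] c[OF b] x] by simp
      finally show "(a \<otimes> b) \<diamondop> x = a \<otimes> b \<otimes> x" .
      have ax: "a \<otimes> x \<in> carrier A" using c[OF a] x by simp
      have ba: "b \<otimes> (a \<otimes> x) = a \<otimes> b \<otimes> x"
        using d(3)[OF b c[OF a]] m_assoc[OF c[OF b] c[OF a] x] by simp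
      have "x \<diamondop> (a \<otimes> b) = (a \<otimes> x) \<diamondop> b"
        unfolding ab using circ_assoc[OF x c[OF a] c[OF b]] d(2)[OF a x] by simp
      also have "\<dots> = a \<otimes> b \<otimes> x" using d(2)[OF b ax] ba by simp
      finally show "x \<diamondop> (a \<otimes> b) = a \<otimes> b \<otimes> x" .
      have "x \<otimes> (a \<otimes> b) = (a \<otimes> x) \<otimes> b" using m_assoc[OF x c[OF a] c[OF b]] d(3)[OF a x] by simp
      also have "\<dots> = a \<otimes> b \<otimes> x" using d(3)[OF b ax] ba by simp
      finally show "x \<otimes> (a \<otimes> b) = a \<otimes> b \<otimes> x" .
    qed
    then show ?thesis using c[OF a] c[OF b] by (simp add: mem_annihilator_iff)
  qed
  have inv: "inv a \<in> ?Z" if a: "a \<in> ?Z" for a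
  proof -
    have ac: "a \<in> carrier A" by (rule c[OF a])
    have "inv a \<diamondop> x = inv a \<otimes> x \<and> x \<diamondop> inv a = inv a \<otimes> x \<and> x \<otimes> inv a = inv a \<otimes> x"
      if x: "x \<in> carrier A" for x
    proof (intro conjI)
      let ?y = "inv a \<otimes> x"
      have y: "?y \<in> carrier A" and ay: "a \<otimes> ?y = x" using ac x by (simp_all flip: m_assoc)
      have ia: "inv a \<diamondop> a = \<one>" "a \<diamondop> inv a = \<one>" using d(1,2)[OF a, of "inv a"] ac by simp_all
      have "inv a \<diamondop> x = inv a \<diamondop> (a \<diamondop> ?y)" using d(1)[OF a y] ay by simp
      also have "\<dots> = ?y" using ia(1) ac y by (simp flip: circ_assoc)
      finally show "inv a \<diamondop> x = ?y" .
      have "x \<diamondop> inv a = (?y \<diamondop> a) \<diamondop> inv a" using d(2)[OF a y] ay by simp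
      also have "\<dots> = ?y" using ia(2) ac y by (simp add: circ_assoc)
      finally show "x \<diamondop> inv a = ?y" .
      have "x \<otimes> inv a = (?y \<otimes> a) \<otimes> inv a" using d(3)[OF a y] ay by simp
      also have "\<dots> = ?y" using ac y by (simp add: m_assoc)
      finally show "x \<otimes> inv a = ?y" .
    qed
    then show ?thesis using ac by (simp add: mem_annihilator_iff)
  qed
  have circ_inv: "inv\<^bsub>circ_group A\<^esub> a = inv a" if a: "a \<in> ?Z" for a
    by (rule C.inv_equality) (use d(2)[OF a, of "inv a"] c[OF a] in simp_all)
  have ne: "?Z \<noteq> {}" using one by blast
  have "?Z \<lhd> A"
  proof (rule normal_invI)
    show "subgroup ?Z A" by (rule subgroupI) (use c mult inv ne in auto)
    fix x z assume x: "x \<in> carrier A" and z: "z \<in> ?Z"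
    have "x \<otimes> z \<otimes> inv x = z" using d(3)[OF z x] x c[OF z] by (simp add: m_assoc)
    then show "x \<otimes> z \<otimes> inv x \<in> ?Z" using z by simp
  qed
  moreover have "?Z \<lhd> circ_group A"
  proof (rule C.normal_invI)
    show "subgroup ?Z (circ_group A)"
    proof (rule C.subgroupI)
      fix a b assume a: "a \<in> ?Z" and b: "b \<in> ?Z"
      show "inv\<^bsub>circ_group A\<^esub> a \<in> ?Z" unfolding circ_inv[OF a] by (rule inv[OF a])
      show "a \<otimes>\<^bsub>circ_group A\<^esub> b \<in> ?Z" using d(1)[OF a c[OF b]] mult[OF a b] by simp
    qed (use c ne in auto)
    fix x z assume x: "x \<in> carrier (circ_group A)" and z: "z \<in> ?Z"
    then have "x \<diamondop> z = z \<diamondop> x" using d(1,2)[OF z] by simp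
    then have "x \<diamondop> z \<diamondop> inv\<^bsub>circ_group A\<^esub> x = z" using x c[OF z] by (simp add: circ_assoc)
    then show "x \<otimes>\<^bsub>circ_group A\<^esub> z \<otimes>\<^bsub>circ_group A\<^esub> inv\<^bsub>circ_group A\<^esub> x \<in> ?Z" using z by simp
  qed
  moreover have "?Z #> a = ?Z #>\<^bsub>circ_group A\<^esub> a" if "a \<in> carrier A" for a
    unfolding r_coset_def using d(1)[OF _ that] by simp
  ultimately show ?thesis by (simp add: brace_ideal_def)
qed

text \<open>
  \<open>Ann A (Suc n)\<close> is the kernel of the composition of two quotient maps, first by \<open>Ann A n\<close> and then by
  the annihilator.
\<close>

lemma (in skew_brace) brace_ideal_Ann: "brace_ideal A (Ann A n)"
proof (induction n)
  case 0
  show ?case using one_is_normal C.one_is_normal by (auto simp: brace_ideal_def r_coset_def)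
next
  case (Suc n)
  let ?Q = "brace_quot A (Ann A n)"
  let ?Z = "annihilator ?Q"
  interpret p: skew_brace_hom A ?Q "\<lambda>a. Ann A n #> a" by (rule brace_quot_hom[OF Suc])
  have Z: "brace_ideal ?Q ?Z" by (rule p.B.brace_ideal_annihilator)
  then interpret Z: normal ?Z ?Q by (simp add: brace_ideal_def)
  let ?r = "(\<lambda>U. ?Z #>\<^bsub>?Q\<^esub> U) \<circ> (\<lambda>a. Ann A n #> a)"
  interpret r: skew_brace_hom A "brace_quot ?Q ?Z" ?r
    by (rule skew_brace_hom_comp[OF p.skew_brace_hom_axioms p.B.brace_quot_hom[OF Z]])
  have "kernel A (brace_quot ?Q ?Z) ?r = Ann A (Suc n)"
    using Z.coset_eq_self_iff[OF p.hom_closed] by (auto simp: kernel_def brace_quot_def[of ?Q])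
  then show ?case using r.brace_ideal_kernel by simp
qed

section \<open>The filtration by word subgroups\<close>

context skew_brace
begin

lemma symbol_op_closed: "\<lbrakk>a \<in> carrier A; b \<in> carrier A\<rbrakk> \<Longrightarrow> symbol_op A e a b \<in> carrier A"
  by (cases e) simp_all

lemma word_val_closed:
  "as \<in> tuples (carrier A) (length m + 1) \<Longrightarrow> word_val A m as \<in> carrier A"
proof (induction m arbitrary: as)
  case Nil
  then show ?case by (auto simp: tuples_def length_Suc_conv)
next
  case (Cons e m)
  then obtain a as' where as: "as = a # as'" by (auto simp: tuples_def length_Suc_conv)
  then have "a \<in> carrier A" "as' \<in> tuples (carrier A) (length m + 1)"
    using Cons.prems by (auto simp: tuples_def)
  then show ?case using Cons.IH symbol_op_closed as by simp
qed

text \<open>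
  The generating set of the subgroup \<open>A\<^sub>(\<^sub>t\<^sub>)\<close>. It is named because the degree is raised on generators only.
\<close>

definition word_values :: "nat \<Rightarrow> 'a set" where
  "word_values t = {word_val A m as | m as. length m \<ge> t \<and> as \<in> tuples (carrier A) (length m + 1)}"

lemma word_subgroup_eq: "word_subgroup A t = generate A (word_values t)"
  by (simp add: word_subgroup_def word_values_def)

lemma word_values_in_carrier: "word_values t \<subseteq> carrier A"
  using word_val_closed by (auto simp: word_values_def)

lemma word_values_Suc: "word_values (Suc t) \<subseteq> word_values t"
  unfolding word_values_def using Suc_leD by blast

lemma symbol_op_word_values:
  assumes "a \<in> carrier A" "w \<in> word_values t"
  shows "symbol_op A e a w \<in> word_values (Suc t)"
proof -
  obtain m as where m: "length m \<ge> t" "as \<in> tuples (carrier A) (length m + 1)" "w = word_val A m as"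
    using assms(2) by (auto simp: word_values_def)
  then have "symbol_op A e a w = word_val A (e # m) (a # as)" "length (e # m) \<ge> Suc t"
    "a # as \<in> tuples (carrier A) (length (e # m) + 1)"
    using assms(1) by (auto simp: tuples_def)
  then show ?thesis unfolding word_values_def by blast
qed

lemma subgroup_word_subgroup: "subgroup (word_subgroup A t) A"
  unfolding word_subgroup_eq by (rule generate_is_subgroup[OF word_values_in_carrier])

lemma word_subgroup_Suc: "word_subgroup A (Suc t) \<subseteq> word_subgroup A t"
  unfolding word_subgroup_eq by (rule mono_generate[OF word_values_Suc])

lemma word_subgroup_0: "word_subgroup A 0 = carrier A"
proof
  show "word_subgroup A 0 \<subseteq> carrier A" by (rule subgroup.subset[OF subgroup_word_subgroup])
  have "a \<in> word_values 0" if "a \<in> carrier A" for a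
  proof -
    have "a = word_val A [] [a]" "[a] \<in> tuples (carrier A) (length ([] :: comm_symbol list) + 1)"
      using that by (simp_all add: tuples_def)
    then show ?thesis unfolding word_values_def by blast
  qed
  then show "carrier A \<subseteq> word_subgroup A 0" unfolding word_subgroup_eq by (auto intro: generate.incl)
qed

lemma normal_word_subgroup: "word_subgroup A t \<lhd> A"
  unfolding word_subgroup_eq
proof (rule normal_generate[OF word_values_in_carrier])
  fix x s assume "x \<in> carrier A" "s \<in> word_values t"
  then have "commutator A x s \<in> word_values (Suc t)"
    using symbol_op_word_values[of x s t Comm] by simp
  then show "commutator A x s \<in> generate A (word_values t)"
    using word_values_Suc by (blast intro: generate.incl)
qed

text \<open>
  Inner automorphisms and the maps \<open>\<lambda>\<^sup>o\<^sup>p\<^sub>a\<close> act trivially on \<open>A\<^sub>(\<^sub>t\<^sub>)\<close> modulo \<open>A\<^sub>(\<^sub>t\<^sub>+\<^sub>1\<^sub>)\<close>: on a word value \<open>s\<close> of degree at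
  least \<open>t\<close> they differ from the identity by \<open>[a, s]\<close> and \<open>a * s\<close>, which are word values of higher degree.
\<close>

lemma conj_word_subgroup:
  assumes a: "a \<in> carrier A" and w: "w \<in> word_subgroup A t"
  shows "word_subgroup A (Suc t) #> (a \<otimes> w \<otimes> inv a) = word_subgroup A (Suc t) #> w"
proof (rule endo_trivial_mod_normal[OF conj_hom[OF a] normal_word_subgroup word_values_in_carrier])
  interpret N: normal "word_subgroup A (Suc t)" A by (rule normal_word_subgroup)
  show "w \<in> generate A (word_values t)" using w by (simp add: word_subgroup_eq)
  fix s assume s: "s \<in> word_values t"
  then have sc: "s \<in> carrier A" using word_values_in_carrier by blast
  have "commutator A a s \<in> word_subgroup A (Suc t)"
    unfolding word_subgroup_eq using symbol_op_word_values[OF a s, of Comm] by (auto intro: generate.incl)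
  then show "word_subgroup A (Suc t) #> (a \<otimes> s \<otimes> inv a) = word_subgroup A (Suc t) #> s"
    using N.coset_eq_iff[of "a \<otimes> s \<otimes> inv a" s] a sc by (simp add: commutator_def)
qed

lemma lambda_op_word_subgroup:
  assumes a: "a \<in> carrier A" and w: "w \<in> word_subgroup A t"
  shows "word_subgroup A (Suc t) #> lambda_op A a w = word_subgroup A (Suc t) #> w"
proof (rule endo_trivial_mod_normal[OF lambda_op_hom[OF a] normal_word_subgroup word_values_in_carrier])
  interpret N: normal "word_subgroup A (Suc t)" A by (rule normal_word_subgroup)
  show "w \<in> generate A (word_values t)" using w by (simp add: word_subgroup_eq)
  fix s assume s: "s \<in> word_values t"
  then have sc: "s \<in> carrier A" using word_values_in_carrier by blast
  have "commutator A a s \<in> word_subgroup A (Suc t)" "star A a s \<in> word_subgroup A (Suc t)"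
    unfolding word_subgroup_eq
    using symbol_op_word_values[OF a s, of Comm] symbol_op_word_values[OF a s, of Star]
    by (auto intro: generate.incl)
  then have "lambda_op A a s \<otimes> inv s \<in> word_subgroup A (Suc t)"
    unfolding lambda_op_mult_inv[OF a sc] using N.inv_op_closed2[OF a] by simp
  then show "word_subgroup A (Suc t) #> lambda_op A a s = word_subgroup A (Suc t) #> s"
    using N.coset_eq_iff[of "lambda_op A a s" s] a sc by simp
qed

lemma lambda_op_word_subgroup_closed:
  assumes a: "a \<in> carrier A" and w: "w \<in> word_subgroup A t"
  shows "lambda_op A a w \<in> word_subgroup A t"
proof -
  interpret N: normal "word_subgroup A (Suc t)" A by (rule normal_word_subgroup)
  interpret W: subgroup "word_subgroup A t" A by (rule subgroup_word_subgroup)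
  have wc: "w \<in> carrier A" by (rule W.mem_carrier[OF w])
  have "lambda_op A a w \<otimes> inv w \<in> word_subgroup A t"
    using N.coset_eq_iff[OF lambda_op_closed[OF a wc] wc] lambda_op_word_subgroup[OF assms]
      word_subgroup_Suc by blast
  from W.m_closed[OF this w] show ?thesis using a wc by (simp add: m_assoc)
qed

section \<open>The lower central series of \<open>\<Lambda>\<^sub>A\<close>\<close>

lemma carrier_Lambda [simp]: "carrier (Lambda_group A) = carrier A \<times> carrier A"
  and mult_Lambda [simp]: "(a, b) \<otimes>\<^bsub>Lambda_group A\<^esub> (c, d) = (a \<otimes> lambda_op A b c, b \<diamondop> d)"
  and one_Lambda [simp]: "\<one>\<^bsub>Lambda_group A\<^esub> = (\<one>, \<one>)"
  by (simp_all add: Lambda_group_def)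

lemma Lambda_left_inverse:
  assumes "a \<in> carrier A" "b \<in> carrier A"
  shows "(lambda_op A (inv\<^bsub>circ_group A\<^esub> b) (inv a), inv\<^bsub>circ_group A\<^esub> b) \<otimes>\<^bsub>Lambda_group A\<^esub> (a, b)
    = \<one>\<^bsub>Lambda_group A\<^esub>"
  using assms by (simp add: lambda_op_one flip: lambda_op_mult)

lemma group_Lambda: "group (Lambda_group A)"
proof (rule groupI)
  fix x assume "x \<in> carrier (Lambda_group A)"
  then obtain a b where "x = (a, b)" "a \<in> carrier A" "b \<in> carrier A" by auto
  then show "\<exists>y \<in> carrier (Lambda_group A). y \<otimes>\<^bsub>Lambda_group A\<^esub> x = \<one>\<^bsub>Lambda_group A\<^esub>"
    using Lambda_left_inverse[of a b]
    by (intro bexI[of _ "(lambda_op A (inv\<^bsub>circ_group A\<^esub> b) (inv a), inv\<^bsub>circ_group A\<^esub> b)"]) simp_all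
qed (auto simp: lambda_op_mult lambda_op_circ m_assoc circ_assoc)

sublocale L: group "Lambda_group A" by (rule group_Lambda)

lemma subgroup_word_subgroup_Lambda:
  "subgroup (word_subgroup A t \<times> word_subgroup A t) (Lambda_group A)"
proof (rule L.subgroupI)
  interpret W: subgroup "word_subgroup A t" A by (rule subgroup_word_subgroup)
  have circ_closed: "v \<diamondop> w \<in> word_subgroup A t" if v: "v \<in> word_subgroup A t" and w: "w \<in> word_subgroup A t" for v w
    unfolding circ_eq[OF W.mem_carrier[OF v] W.mem_carrier[OF w]]
    using lambda_op_word_subgroup_closed[OF W.mem_carrier[OF v] w] v by simp
  have circ_inv_closed: "inv\<^bsub>circ_group A\<^esub> v \<in> word_subgroup A t" if v: "v \<in> word_subgroup A t" for v
  proof -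
    let ?v = "inv\<^bsub>circ_group A\<^esub> v"
    have vc: "v \<in> carrier A" "?v \<in> carrier A" using W.mem_carrier[OF v] by simp_all
    have eq: "lambda_op A ?v v \<otimes> ?v = \<one>" using circ_eq[OF vc(2,1)] vc by simp
    have "inv (lambda_op A ?v v) = ?v"
      by (rule inv_equality) (use eq vc in \<open>auto simp: inv_comm\<close>)
    then show ?thesis using lambda_op_word_subgroup_closed[OF vc(2) v] W.m_inv_closed by metis
  qed
  show "word_subgroup A t \<times> word_subgroup A t \<subseteq> carrier (Lambda_group A)" using W.subset by auto
  show "word_subgroup A t \<times> word_subgroup A t \<noteq> {}" using W.one_closed by blast
  fix x assume x: "x \<in> word_subgroup A t \<times> word_subgroup A t"
  then obtain a b where ab: "x = (a, b)" "a \<in> word_subgroup A t" "b \<in> word_subgroup A t" by auto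
  have "inv\<^bsub>Lambda_group A\<^esub> x = (lambda_op A (inv\<^bsub>circ_group A\<^esub> b) (inv a), inv\<^bsub>circ_group A\<^esub> b)"
    unfolding ab(1) by (rule L.inv_equality[OF Lambda_left_inverse]) (use ab in \<open>simp_all add: W.mem_carrier\<close>)
  then show "inv\<^bsub>Lambda_group A\<^esub> x \<in> word_subgroup A t \<times> word_subgroup A t"
    using circ_inv_closed[OF ab(3)] lambda_op_word_subgroup_closed[of "inv\<^bsub>circ_group A\<^esub> b" "inv a" t] ab
    by (simp add: W.mem_carrier)
  fix y assume "y \<in> word_subgroup A t \<times> word_subgroup A t"
  then obtain c d where cd: "y = (c, d)" "c \<in> word_subgroup A t" "d \<in> word_subgroup A t" by auto
  show "x \<otimes>\<^bsub>Lambda_group A\<^esub> y \<in> word_subgroup A t \<times> word_subgroup A t"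
    using ab cd circ_closed lambda_op_word_subgroup_closed[of b c t] by (simp add: W.mem_carrier)
qed

text \<open>
  In \<open>\<Lambda>\<^sub>A\<close>, conjugation of \<open>(w, 1)\<close> by \<open>(a, b)\<close> is \<open>\<lambda>\<^sup>o\<^sup>p\<^sub>b\<close> followed by conjugation by \<open>a\<close>, so the last two
  lemmas say that the word subgroups form a central filtration of \<open>\<Lambda>\<^sub>A\<close>.
\<close>

lemma central_filtration_Lambda:
  "central_filtration (Lambda_group A) (\<lambda>t. word_subgroup A t \<times> {\<one>})"
proof (intro central_filtration.intro central_filtration_axioms.intro group_Lambda)
  fix t
  interpret W: subgroup "word_subgroup A t" A by (rule subgroup_word_subgroup)
  show "subgroup (word_subgroup A t \<times> {\<one>}) (Lambda_group A)"
  proof (rule L.subgroupI)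
    show "word_subgroup A t \<times> {\<one>} \<noteq> {}" using W.one_closed by blast
    fix x assume "x \<in> word_subgroup A t \<times> {\<one>}"
    then obtain w where w: "x = (w, \<one>)" "w \<in> word_subgroup A t" by auto
    have "inv\<^bsub>Lambda_group A\<^esub> x = (inv w, \<one>)"
      unfolding w(1) by (rule L.inv_equality) (use w W.mem_carrier in simp_all)
    then show "inv\<^bsub>Lambda_group A\<^esub> x \<in> word_subgroup A t \<times> {\<one>}" using w by simp
  qed (auto simp: W.mem_carrier)
  show "word_subgroup A (Suc t) \<times> {\<one>} \<subseteq> word_subgroup A t \<times> {\<one>}" using word_subgroup_Suc by auto
  fix g x assume "g \<in> carrier (Lambda_group A)" "x \<in> word_subgroup A t \<times> {\<one>}"
  then obtain a b w where g: "g = (a, b)" "a \<in> carrier A" "b \<in> carrier A"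
    and x: "x = (w, \<one>)" "w \<in> word_subgroup A t" by auto
  have wc: "w \<in> carrier A" by (rule W.mem_carrier[OF x(2)])
  let ?c = "(a \<otimes> lambda_op A b w \<otimes> inv a) \<otimes> inv w"
  have "commutator (Lambda_group A) g x = (?c, \<one>)"
    unfolding g(1) x(1) by (rule L.commutator_eqI) (use g x wc in \<open>simp_all add: m_assoc\<close>)
  moreover have "?c \<in> word_subgroup A (Suc t)"
  proof -
    interpret N: normal "word_subgroup A (Suc t)" A by (rule normal_word_subgroup)
    have "word_subgroup A (Suc t) #> (a \<otimes> lambda_op A b w \<otimes> inv a) = word_subgroup A (Suc t) #> w"
      using conj_word_subgroup[OF g(2) lambda_op_word_subgroup_closed[OF g(3) x(2)]]
        lambda_op_word_subgroup[OF g(3) x(2)] by simp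
    then show ?thesis using N.coset_eq_iff g wc by simp
  qed
  ultimately show "commutator (Lambda_group A) g x \<in> word_subgroup A (Suc t) \<times> {\<one>}" by simp
qed

text \<open>
  The three subgroups lemma applied to \<open>A = A\<^sub>(\<^sub>0\<^sub>)\<close>. The operator \<open>\<lambda>\<^sup>o\<^sup>p\<^sub>v\<close> with \<open>v\<close> from a lower central
  term is thereby known modulo a word subgroup. Writing \<open>v\<close> as a product of word values would not serve here:
  the operator depends on \<open>v\<close> multiplicatively for \<open>\<diamondop>\<close> only.
\<close>

lemma lower_central_Lambda_acts:
  assumes xv: "(x, v) \<in> lower_central (Lambda_group A) (Suc k)" and y: "y \<in> carrier A"
  shows "word_subgroup A (Suc k) #> (x \<otimes> lambda_op A v y) = word_subgroup A (Suc k) #> (y \<otimes> x)"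
proof -
  interpret N: normal "word_subgroup A (Suc k)" A by (rule normal_word_subgroup)
  have c: "x \<in> carrier A" "v \<in> carrier A" using L.lower_central_in_carrier[OF xv] by simp_all
  have "commutator (Lambda_group A) (x, v) (y, \<one>) = ((x \<otimes> lambda_op A v y \<otimes> inv x) \<otimes> inv y, \<one>)"
    by (rule L.commutator_eqI) (use c y in \<open>simp_all add: m_assoc\<close>)
  moreover have "commutator (Lambda_group A) (x, v) (y, \<one>) \<in> word_subgroup A (Suc k) \<times> {\<one>}"
    using central_filtration.commutator_lower_central_V[OF central_filtration_Lambda xv, of "(y, \<one>)" 0] y
    by (simp add: word_subgroup_0)
  ultimately show ?thesis
    using N.coset_eq_iff[of "x \<otimes> lambda_op A v y" "y \<otimes> x"] c y by (simp add: inv_mult_group m_assoc)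
qed

text \<open>
  By induction, a commutator \<open>(s1, s2)\<close> of \<open>(a, b)\<close> and \<open>(x, v)\<close> has to be shown trivial modulo \<open>A\<^sub>(\<^sub>k\<^sub>+\<^sub>1\<^sub>)\<close> in
  both components. Both sides of \<open>(s1, s2) ((x, v) (a, b)) = (a, b) (x, v)\<close> are computed modulo
  \<open>A\<^sub>(\<^sub>k\<^sub>+\<^sub>1\<^sub>)\<close>, where \<open>x\<close> and \<open>v\<close> are central and fixed by the maps \<open>\<lambda>\<^sup>o\<^sup>p\<close>; the maps \<open>\<lambda>\<^sup>o\<^sup>p\<^sub>v\<close> and \<open>\<lambda>\<^sup>o\<^sup>p\<^sub>s\<^sub>2\<close>
  that remain are handled by \<open>lower_central_Lambda_acts\<close>.
\<close>

lemma lower_central_Lambda: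
  "lower_central (Lambda_group A) (Suc k) \<subseteq> word_subgroup A k \<times> word_subgroup A k"
proof (induction k)
  case 0
  show ?case by (simp add: word_subgroup_0)
next
  case (Suc k)
  let ?N = "word_subgroup A (Suc k)"
  let ?Q = "A Mod ?N"
  interpret N: normal ?N A by (rule normal_word_subgroup)
  interpret q: group_hom A ?Q "\<lambda>x. ?N #> x" by (rule N.coset_hom)
  have "commutator (Lambda_group A) g u \<in> ?N \<times> ?N"
    if gc: "g \<in> carrier (Lambda_group A)" and u: "u \<in> lower_central (Lambda_group A) (Suc k)" for g u
  proof -
    obtain a b where g: "g = (a, b)" and ab: "a \<in> carrier A" "b \<in> carrier A" using gc by auto
    obtain x v where u_eq: "u = (x, v)" by fastforce
    have xW: "x \<in> word_subgroup A k" and vW: "v \<in> word_subgroup A k" using Suc.IH u u_eq by auto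
    have xv: "x \<in> carrier A" "v \<in> carrier A" using L.lower_central_in_carrier[OF u] u_eq by simp_all
    obtain s1 s2 where s_eq: "commutator (Lambda_group A) g u = (s1, s2)" by fastforce
    have s: "(s1, s2) \<in> lower_central (Lambda_group A) (Suc (Suc k))"
      unfolding s_eq[symmetric] by (rule L.lower_central_commutator[OF gc u])
    have sc: "s1 \<in> carrier A" "s2 \<in> carrier A" using L.lower_central_in_carrier[OF s] by simp_all
    define y z where "y = x \<otimes> lambda_op A v a" and "z = v \<diamondop> b"
    have yz: "y \<in> carrier A" "z \<in> carrier A" using ab xv by (simp_all add: y_def z_def)
    have "(s1, s2) \<otimes>\<^bsub>Lambda_group A\<^esub> (y, z) = (a, b) \<otimes>\<^bsub>Lambda_group A\<^esub> (x, v)"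
      using L.commutator_mult[of "(a, b)" "(x, v)"] s_eq g u_eq ab xv by (simp add: y_def z_def)
    then have eq1: "s1 \<otimes> lambda_op A s2 y = a \<otimes> lambda_op A b x" and eq2: "s2 \<diamondop> z = b \<diamondop> v"
      by simp_all
    have cQ: "?N #> c \<in> carrier ?Q" if "c \<in> carrier A" for c using that by (rule q.hom_closed)
    have qm: "?N #> (c \<otimes> d) = (?N #> c) \<otimes>\<^bsub>?Q\<^esub> (?N #> d)" if "c \<in> carrier A" "d \<in> carrier A" for c d
      using that by (rule q.hom_mult)
    have s_acts: "?N #> (s1 \<otimes> lambda_op A s2 c) = ?N #> (c \<otimes> s1)" if c: "c \<in> carrier A" for c
    proof -
      interpret N': normal "word_subgroup A (Suc (Suc k))" A by (rule normal_word_subgroup)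
      show ?thesis
        using lower_central_Lambda_acts[OF s c] word_subgroup_Suc[of "Suc k"] sc c
          N'.coset_eq_iff[of "s1 \<otimes> lambda_op A s2 c" "c \<otimes> s1"]
          N.coset_eq_iff[of "s1 \<otimes> lambda_op A s2 c" "c \<otimes> s1"] by auto
    qed
    have comm: "?N #> (w \<otimes> c) = ?N #> (c \<otimes> w)" if w: "w \<in> word_subgroup A k" and c: "c \<in> carrier A" for c w
    proof -
      have wc: "w \<in> carrier A" by (rule subgroup.mem_carrier[OF subgroup_word_subgroup w])
      have "?N #> (c \<otimes> w) = ?N #> ((c \<otimes> w \<otimes> inv c) \<otimes> c)" using c wc by (simp add: m_assoc)
      also have "\<dots> = (?N #> (c \<otimes> w \<otimes> inv c)) \<otimes>\<^bsub>?Q\<^esub> (?N #> c)" by (rule qm) (use c wc in simp_all)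
      also have "\<dots> = ?N #> (w \<otimes> c)" unfolding conj_word_subgroup[OF c w] using qm[OF wc c] by simp
      finally show ?thesis by simp
    qed
    \<comment> \<open>First component: modulo \<open>?N\<close> both sides are \<open>y\<close>, up to the factor \<open>s1\<close>.\<close>
    have "?N #> (a \<otimes> x) = ?N #> y"
      unfolding y_def using lower_central_Lambda_acts[of x v k a] u u_eq ab by simp
    have "?N #> (a \<otimes> x) = ?N #> (a \<otimes> lambda_op A b x)"
      unfolding qm[OF ab(1) xv(1)] qm[OF ab(1) lambda_op_closed[OF ab(2) xv(1)]]
        lambda_op_word_subgroup[OF ab(2) xW] ..
    also have "\<dots> = ?N #> (y \<otimes> s1)" unfolding eq1[symmetric] by (rule s_acts[OF yz(1)])
    also have "\<dots> = (?N #> y) \<otimes>\<^bsub>?Q\<^esub> (?N #> s1)" by (rule qm[OF yz(1) sc(1)])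
    finally have "(?N #> y) \<otimes>\<^bsub>?Q\<^esub> (?N #> s1) = ?N #> y" unfolding \<open>?N #> (a \<otimes> x) = ?N #> y\<close> ..
    then have qs1: "?N #> s1 = \<one>\<^bsub>?Q\<^esub>" by (simp only: q.H.l_cancel_one[OF cQ[OF yz(1)] cQ[OF sc(1)]])
    \<comment> \<open>Second component: since \<open>\<lambda>\<^sup>o\<^sup>p\<^sub>v\<close> fixes \<open>b\<close>, the products \<open>v \<diamondop> b\<close> and \<open>b \<diamondop> v\<close> agree modulo \<open>?N\<close>; they differ by \<open>s2\<close>.\<close>
    have "(?N #> x) \<otimes>\<^bsub>?Q\<^esub> (?N #> lambda_op A v b) = (?N #> x) \<otimes>\<^bsub>?Q\<^esub> (?N #> b)"
      using lower_central_Lambda_acts[of x v k b] u u_eq comm[OF xW ab(2)] qm[OF xv(1) ab(2)]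
        qm[OF xv(1) lambda_op_closed[OF xv(2) ab(2)]] ab by simp
    then have vb: "?N #> lambda_op A v b = ?N #> b"
      by (rule q.H.l_cancel[OF _ cQ[OF lambda_op_closed[OF xv(2) ab(2)]] cQ[OF ab(2)] cQ[OF xv(1)]])
    have "?N #> z = ?N #> (b \<otimes> v)"
      unfolding z_def circ_eq[OF xv(2) ab(2)] qm[OF lambda_op_closed[OF xv(2) ab(2)] xv(2)] vb
      using qm[OF ab(2) xv(2)] by simp
    also have "\<dots> = (?N #> lambda_op A b v) \<otimes>\<^bsub>?Q\<^esub> (?N #> b)"
      unfolding lambda_op_word_subgroup[OF ab(2) vW] qm[OF xv(2) ab(2), symmetric] using comm[OF vW ab(2)] by simp
    also have "\<dots> = ?N #> (b \<diamondop> v)"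
      unfolding circ_eq[OF ab(2) xv(2)] by (rule qm[symmetric]) (use ab xv in simp_all)
    also have "\<dots> = ?N #> (lambda_op A s2 z \<otimes> s2)" unfolding eq2[symmetric] using circ_eq sc yz by simp
    also have "\<dots> = (?N #> lambda_op A s2 z) \<otimes>\<^bsub>?Q\<^esub> (?N #> s2)" by (rule qm) (use sc yz in simp_all)
    also have "?N #> lambda_op A s2 z = ?N #> z"
      using s_acts[OF yz(2)] qm[OF sc(1) lambda_op_closed[OF sc(2) yz(2)]] qm[OF yz(2) sc(1)] qs1
        q.H.l_one[OF cQ[OF lambda_op_closed[OF sc(2) yz(2)]]] q.H.r_one[OF cQ[OF yz(2)]] by metis
    finally have "(?N #> z) \<otimes>\<^bsub>?Q\<^esub> (?N #> s2) = ?N #> z" ..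
    then have qs2: "?N #> s2 = \<one>\<^bsub>?Q\<^esub>" by (simp only: q.H.l_cancel_one[OF cQ[OF yz(2)] cQ[OF sc(2)]])
    show ?thesis unfolding s_eq using qs1 qs2 sc by (simp add: N.coset_eq_self_iff)
  qed
  then show ?case
    using L.generate_subgroup_incl[OF _ subgroup_word_subgroup_Lambda,
      of "\<Union>g \<in> carrier (Lambda_group A). \<Union>u \<in> lower_central (Lambda_group A) (Suc k). {commutator (Lambda_group A) g u}" "Suc k"]
    unfolding lower_central.simps by blast
qed

end

lemma (in skew_brace_hom) group_isoclinic_Lambda:
  assumes surj: "h ` carrier A = carrier B" and inj: "inj_on h (word_subgroup A n)"
  shows "group_isoclinic n (Lambda_group A) (Lambda_group B)"
proof -
  have "map_prod h h \<in> hom (Lambda_group A) (Lambda_group B)"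
    by (rule homI) (auto simp: hom_lambda_op)
  then interpret L: group_hom "Lambda_group A" "Lambda_group B" "map_prod h h"
    by (simp add: group_hom_def group_hom_axioms_def A.group_Lambda B.group_Lambda)
  show ?thesis
  proof (rule L.group_isoclinic_of_surj)
    show "map_prod h h ` carrier (Lambda_group A) = carrier (Lambda_group B)"
      using surj by (simp add: map_prod_surj_on)
    show "inj_on (map_prod h h) (lower_central (Lambda_group A) (Suc n))"
      by (rule inj_on_subset[OF map_prod_inj_on[OF inj inj] A.lower_central_Lambda])
  qed
qed

section \<open>Fibre products of skew braces\<close>

lemma (in skew_brace_hom) hom_symbol_op:
  "\<lbrakk>a \<in> carrier A; b \<in> carrier A\<rbrakk> \<Longrightarrow> h (symbol_op A e a b) = symbol_op B e (h a) (h b)"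
  by (cases e) (simp_all add: hom_star hom_commutator)

lemma (in skew_brace_hom) hom_word_val:
  "as \<in> tuples (carrier A) (length m + 1) \<Longrightarrow> h (word_val A m as) = word_val B m (map h as)"
proof (induction m arbitrary: as)
  case Nil
  then show ?case by (auto simp: tuples_def length_Suc_conv)
next
  case (Cons e m)
  then obtain a as' where as: "as = a # as'" by (auto simp: tuples_def length_Suc_conv)
  then have "a \<in> carrier A" "as' \<in> tuples (carrier A) (length m + 1)"
    using Cons.prems by (auto simp: tuples_def)
  then show ?case using Cons.IH A.word_val_closed as by (simp add: hom_symbol_op)
qed

text \<open>
  A long word is a short one with a word value as its last argument.
\<close>

lemma word_val_append:
  "length as = length m \<Longrightarrow>
    word_val A (m @ m') (as @ as') = word_val A m (as @ [word_val A m' as'])"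
  by (induction as m rule: list_induct2) simp_all

definition fibre_product ::
  "('a, 'm) brace_scheme \<Rightarrow> ('b, 'k) brace_scheme \<Rightarrow> ('a \<Rightarrow> 'c) \<Rightarrow> ('b \<Rightarrow> 'c) \<Rightarrow> ('a \<times> 'b) brace" where
  "fibre_product A B f g =
    \<lparr>carrier = {(a, b). a \<in> carrier A \<and> b \<in> carrier B \<and> f a = g b},
     monoid.mult = (\<lambda>(a, b) (a', b'). (a \<otimes>\<^bsub>A\<^esub> a', b \<otimes>\<^bsub>B\<^esub> b')), one = (\<one>\<^bsub>A\<^esub>, \<one>\<^bsub>B\<^esub>),
     circ = (\<lambda>(a, b) (a', b'). (a \<diamondop>\<^bsub>A\<^esub> a', b \<diamondop>\<^bsub>B\<^esub> b'))\<rparr>"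

text \<open>
  The fibre product of two surjections is used with \<open>Q\<close> the quotient of \<open>B\<close> by \<open>Ann\<^sub>n(B)\<close>: it then consists
  of the pairs whose classes correspond under the isomorphism of the quotients.
\<close>

locale skew_brace_cospan = f: skew_brace_hom A Q f + g: skew_brace_hom B Q g
  for A :: "('a, 'm) brace_scheme" and B :: "('b, 'k) brace_scheme" and Q :: "('c, 'l) brace_scheme"
    and f g +
  assumes f_surj: "f ` carrier A = carrier Q" and g_surj: "g ` carrier B = carrier Q"
begin

abbreviation P where "P \<equiv> fibre_product A B f g"

lemma fibre_product_simps [simp]:
  "(a, b) \<in> carrier P \<longleftrightarrow> a \<in> carrier A \<and> b \<in> carrier B \<and> f a = g b"
  "(a, b) \<otimes>\<^bsub>P\<^esub> (a', b') = (a \<otimes>\<^bsub>A\<^esub> a', b \<otimes>\<^bsub>B\<^esub> b')"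
  "(a, b) \<diamondop>\<^bsub>P\<^esub> (a', b') = (a \<diamondop>\<^bsub>A\<^esub> a', b \<diamondop>\<^bsub>B\<^esub> b')"
  "\<one>\<^bsub>P\<^esub> = (\<one>\<^bsub>A\<^esub>, \<one>\<^bsub>B\<^esub>)"
  by (simp_all add: fibre_product_def)

lemma group_P: "group P"
proof (rule groupI)
  fix x assume "x \<in> carrier P"
  then obtain a b where x: "x = (a, b)" "a \<in> carrier A" "b \<in> carrier B" "f a = g b" by (cases x) auto
  then show "\<exists>y \<in> carrier P. y \<otimes>\<^bsub>P\<^esub> x = \<one>\<^bsub>P\<^esub>"
    by (intro bexI[of _ "(inv\<^bsub>A\<^esub> a, inv\<^bsub>B\<^esub> b)"]) simp_all
qed (auto simp: f.A.m_assoc g.A.m_assoc)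

lemma group_circ_P: "group (circ_group P)"
proof (rule groupI)
  fix x assume "x \<in> carrier (circ_group P)"
  then obtain a b where x: "x = (a, b)" "a \<in> carrier A" "b \<in> carrier B" "f a = g b" by (cases x) auto
  then show "\<exists>y \<in> carrier (circ_group P). y \<otimes>\<^bsub>circ_group P\<^esub> x = \<one>\<^bsub>circ_group P\<^esub>"
    using f.C.hom_inv[of a] g.C.hom_inv[of b]
    by (intro bexI[of _ "(inv\<^bsub>circ_group A\<^esub> a, inv\<^bsub>circ_group B\<^esub> b)"]) simp_all
qed (auto simp: f.A.circ_assoc g.A.circ_assoc)

lemma inv_P: "(a, b) \<in> carrier P \<Longrightarrow> inv\<^bsub>P\<^esub> (a, b) = (inv\<^bsub>A\<^esub> a, inv\<^bsub>B\<^esub> b)"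
  by (rule group.inv_equality[OF group_P]) simp_all

lemma skew_brace_P: "skew_brace P"
proof (intro skew_brace.intro skew_brace_axioms.intro group_P group_circ_P)
  fix x y z assume xyz: "x \<in> carrier P" "y \<in> carrier P" "z \<in> carrier P"
  obtain x1 x2 y1 y2 z1 z2 where eq: "x = (x1, x2)" "y = (y1, y2)" "z = (z1, z2)" by fastforce
  show "x \<diamondop>\<^bsub>P\<^esub> (y \<otimes>\<^bsub>P\<^esub> z) = x \<diamondop>\<^bsub>P\<^esub> y \<otimes>\<^bsub>P\<^esub> inv\<^bsub>P\<^esub> x \<otimes>\<^bsub>P\<^esub> (x \<diamondop>\<^bsub>P\<^esub> z)"
    using xyz unfolding eq by (simp add: inv_P f.A.brace_law g.A.brace_law)
qed

lemma fst_hom: "skew_brace_hom P A fst"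
  by (intro skew_brace_hom.intro skew_brace_hom_axioms.intro skew_brace_P f.A.skew_brace_axioms)
    (auto simp: brace_hom_def intro!: homI)

lemma snd_hom: "skew_brace_hom P B snd"
  by (intro skew_brace_hom.intro skew_brace_hom_axioms.intro skew_brace_P g.A.skew_brace_axioms)
    (auto simp: brace_hom_def intro!: homI)

lemma fst_surj: "fst ` carrier P = carrier A"
proof
  show "carrier A \<subseteq> fst ` carrier P"
  proof
    fix a assume a: "a \<in> carrier A"
    then obtain b where "b \<in> carrier B" "f a = g b" using f_surj g_surj by blast
    then have "(a, b) \<in> carrier P" using a by simp
    then show "a \<in> fst ` carrier P" by (rule image_eqI[rotated]) simp
  qed
qed auto

lemma snd_surj: "snd ` carrier P = carrier B"
proof
  show "carrier B \<subseteq> snd ` carrier P"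
  proof
    fix b assume b: "b \<in> carrier B"
    then have "g b \<in> f ` carrier A" using f_surj g_surj by blast
    then obtain a where "a \<in> carrier A" "f a = g b" by (metis imageE)
    then have "(a, b) \<in> carrier P" using b by simp
    then show "b \<in> snd ` carrier P" by (rule image_eqI[rotated]) simp
  qed
qed auto

text \<open>
  The graph of \<open>\<theta>\<close> is a subgroup, so only word values matter, and \<open>compat\<close> extends from degree \<open>n\<close> to
  all higher degrees by splitting the word.
\<close>

lemma word_subgroup_P_graph:
  assumes \<theta>: "\<theta> \<in> hom (word_brace A n) (word_brace B n)"
    and compat: "\<And>m ps. \<lbrakk>length m = n; ps \<in> tuples (carrier P) (n + 1)\<rbrakk>
      \<Longrightarrow> \<theta> (word_val A m (map fst ps)) = word_val B m (map snd ps)"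
    and x: "x \<in> word_subgroup P n"
  shows "fst x \<in> word_subgroup A n \<and> snd x = \<theta> (fst x)"
proof -
  interpret P: skew_brace P by (rule skew_brace_P)
  interpret p: skew_brace_hom P A fst by (rule fst_hom)
  interpret q: skew_brace_hom P B snd by (rule snd_hom)
  interpret WA: subgroup "word_subgroup A n" A by (rule f.A.subgroup_word_subgroup)
  let ?WA = "A\<lparr>carrier := word_subgroup A n\<rparr>" and ?WB = "B\<lparr>carrier := word_subgroup B n\<rparr>"
  interpret t: group_hom ?WA ?WB \<theta>
    using \<theta> WA.subgroup_is_group[OF f.A.is_group]
      subgroup.subgroup_is_group[OF g.A.subgroup_word_subgroup g.A.is_group]
    by (simp add: group_hom_def group_hom_axioms_def word_brace_def)
  have gen: "fst x \<in> word_subgroup A n \<and> snd x = \<theta> (fst x)" if x: "x \<in> P.word_values n" for x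
  proof -
    obtain m ps where m: "length m \<ge> n" "ps \<in> tuples (carrier P) (length m + 1)" "x = word_val P m ps"
      using x unfolding P.word_values_def by blast
    have psA: "map fst ps \<in> tuples (carrier A) (length m + 1)"
      using m(2) by (auto simp: tuples_def)
    have x1: "fst x = word_val A m (map fst ps)" unfolding m(3) by (rule p.hom_word_val[OF m(2)])
    have "fst x \<in> f.A.word_values n"
      unfolding x1 f.A.word_values_def using m(1) psA by blast
    then have mem: "fst x \<in> word_subgroup A n"
      unfolding f.A.word_subgroup_eq by (rule generate.incl)
    \<comment> \<open>Only the first \<open>n\<close> symbols are kept; the rest is evaluated into the last argument \<open>y\<close>.\<close>
    define m1 m2 qs rs where "m1 = take n m" and "m2 = drop n m" and "qs = take n ps" and "rs = drop n ps"
    have split: "m = m1 @ m2" "ps = qs @ rs" "length m1 = n" "length qs = n"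
      using m(1,2) by (simp_all add: m1_def m2_def qs_def rs_def tuples_def)
    have rs: "rs \<in> tuples (carrier P) (length m2 + 1)" and qs: "set qs \<subseteq> carrier P"
      using m(1,2) set_drop_subset[of n ps] set_take_subset[of n ps]
      by (auto simp: m2_def rs_def qs_def tuples_def)
    define y where "y = word_val P m2 rs"
    have "y \<in> carrier P" unfolding y_def by (rule P.word_val_closed[OF rs])
    then have t: "qs @ [y] \<in> tuples (carrier P) (n + 1)" using qs split by (simp add: tuples_def)
    have "x = word_val P m1 (qs @ [y])"
      unfolding m(3) split(1,2) y_def by (rule word_val_append) (simp add: split)
    then have "fst x = word_val A m1 (map fst (qs @ [y]))" "snd x = word_val B m1 (map snd (qs @ [y]))"
      using p.hom_word_val[of "qs @ [y]" m1] q.hom_word_val[of "qs @ [y]" m1] t split(3) by simp_all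
    then show ?thesis using compat[OF split(3) t] mem by simp
  qed
  have carr: "x \<in> carrier P" if "x \<in> generate P (P.word_values n)" for x
    by (rule P.generate_in_carrier[OF P.word_values_in_carrier that])
  have "x \<in> generate P (P.word_values n)" using x by (simp add: P.word_subgroup_eq)
  then show ?thesis
  proof (induction x rule: generate.induct)
    case one
    then show ?case using t.hom_one WA.one_closed by simp
  next
    case (incl x)
    then show ?case by (rule gen)
  next
    case (inv x)
    have xc: "x \<in> carrier P" using inv P.word_values_in_carrier by blast
    have mem: "fst x \<in> word_subgroup A n" and snd: "snd x = \<theta> (fst x)" using gen[OF inv] by simp_all
    have "snd (inv\<^bsub>P\<^esub> x) = inv\<^bsub>B\<^esub> (\<theta> (fst x))" using q.hom_inv[OF xc] snd by simp
    also have "\<dots> = inv\<^bsub>?WB\<^esub> (\<theta> (fst x))"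
      using g.A.m_inv_consistent[OF g.A.subgroup_word_subgroup, of "\<theta> (fst x)" n] t.hom_closed[of "fst x"] mem by simp
    also have "\<dots> = \<theta> (inv\<^bsub>?WA\<^esub> (fst x))" using t.hom_inv[of "fst x"] mem by simp
    also have "\<dots> = \<theta> (fst (inv\<^bsub>P\<^esub> x))"
      using f.A.m_inv_consistent[OF f.A.subgroup_word_subgroup mem] p.hom_inv[OF xc] by simp
    finally show ?case using p.hom_inv[OF xc] mem by simp
  next
    case (eng x y)
    have c: "x \<in> carrier P" "y \<in> carrier P" using carr eng by blast+
    show ?case
      using eng.IH p.hom_mult[OF c] q.hom_mult[OF c] t.hom_mult[of "fst x" "fst y"] by simp
  qed
qed

lemma group_isoclinic_Lambda_cospan:
  assumes \<theta>: "\<theta> \<in> hom (word_brace A n) (word_brace B n)" and inj: "inj_on \<theta> (word_subgroup A n)"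
    and compat: "\<And>m ps. \<lbrakk>length m = n; ps \<in> tuples (carrier P) (n + 1)\<rbrakk>
      \<Longrightarrow> \<theta> (word_val A m (map fst ps)) = word_val B m (map snd ps)"
  shows "group_isoclinic n (Lambda_group A) (Lambda_group B)"
proof -
  interpret P: skew_brace P by (rule skew_brace_P)
  interpret p: skew_brace_hom P A fst by (rule fst_hom)
  interpret q: skew_brace_hom P B snd by (rule snd_hom)
  note graph = word_subgroup_P_graph[OF \<theta> compat]
  have "inj_on fst (word_subgroup P n)"
    by (rule inj_onI) (use graph in \<open>metis prod_eqI\<close>)
  then have PA: "group_isoclinic n (Lambda_group P) (Lambda_group A)"
    by (rule p.group_isoclinic_Lambda[OF fst_surj])
  have "inj_on snd (word_subgroup P n)"
  proof (rule inj_onI)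
    fix x y assume x: "x \<in> word_subgroup P n" and y: "y \<in> word_subgroup P n" and eq: "snd x = snd y"
    have "fst x = fst y"
      using inj_onD[OF inj, of "fst x" "fst y"] graph[OF _ _ x] graph[OF _ _ y] eq by simp
    then show "x = y" using eq by (rule prod_eqI)
  qed
  then have PB: "group_isoclinic n (Lambda_group P) (Lambda_group B)"
    by (rule q.group_isoclinic_Lambda[OF snd_surj])
  have "group_isoclinic n (Lambda_group A) (Lambda_group P)"
    by (rule group_isoclinic_sym[OF P.group_Lambda f.A.group_Lambda PA])
  then show ?thesis
    by (rule group_isoclinic_trans[OF f.A.group_Lambda P.group_Lambda g.A.group_Lambda _ PB])
qed

end

section \<open>Isoclinic skew braces have isoclinic groups\<close>

theorem theoremE:
  fixes A :: "('a, 'm) brace_scheme" and B :: "('b, 'k) brace_scheme" and n :: nat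
  assumes "n \<ge> 1"
    and "class_I n A" and "class_I n B"
    and "brace_isoclinic n A B"
    and "word_subgroup A n = Gamma A (n + 1)"
    and "word_subgroup B n = Gamma B (n + 1)"
  shows "group_isoclinic n (Lambda_group A) (Lambda_group B)"
proof -
  interpret A: skew_brace A using assms(2) by (simp add: class_I_def)
  interpret B: skew_brace B using assms(3) by (simp add: class_I_def)
  let ?QA = "ann_quot A n" and ?QB = "ann_quot B n"
  interpret a: skew_brace_hom A ?QA "\<lambda>x. Ann A n #>\<^bsub>A\<^esub> x"
    unfolding ann_quot_def by (rule A.brace_quot_hom[OF A.brace_ideal_Ann])
  interpret b: skew_brace_hom B ?QB "\<lambda>x. Ann B n #>\<^bsub>B\<^esub> x"
    unfolding ann_quot_def by (rule B.brace_quot_hom[OF B.brace_ideal_Ann])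
  obtain \<xi> \<theta> where \<xi>: "\<xi> \<in> brace_iso ?QA ?QB" and \<theta>: "\<theta> \<in> brace_iso (word_brace A n) (word_brace B n)"
    and phi: "\<And>m Us. \<lbrakk>length m = n; Us \<in> tuples (carrier ?QA) (n + 1)\<rbrakk>
      \<Longrightarrow> \<theta> (phi A n m Us) = phi B n m (map \<xi> Us)"
    using assms(4) unfolding brace_isoclinic_def by blast
  have surjA: "(\<lambda>x. Ann A n #>\<^bsub>A\<^esub> x) ` carrier A = carrier ?QA"
    and surjB: "(\<lambda>x. Ann B n #>\<^bsub>B\<^esub> x) ` carrier B = carrier ?QB"
    by (auto simp: ann_quot_def brace_quot_def RCOSETS_def)
  have \<xi>_surj: "\<xi> ` carrier ?QA = carrier ?QB" using \<xi> by (simp add: brace_iso_def bij_betw_def)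
  interpret xi: skew_brace_hom ?QA ?QB \<xi>
    by (intro skew_brace_hom.intro skew_brace_hom_axioms.intro a.B.skew_brace_axioms b.B.skew_brace_axioms)
      (use \<xi> in \<open>simp add: brace_iso_def\<close>)
  let ?f = "\<xi> \<circ> (\<lambda>x. Ann A n #>\<^bsub>A\<^esub> x)" and ?g = "\<lambda>x. Ann B n #>\<^bsub>B\<^esub> x"
  interpret f: skew_brace_hom A ?QB ?f
    by (rule skew_brace_hom_comp[OF a.skew_brace_hom_axioms xi.skew_brace_hom_axioms])
  interpret skew_brace_cospan A B ?QB ?f ?g
    by (intro skew_brace_cospan.intro skew_brace_cospan_axioms.intro f.skew_brace_hom_axioms
        b.skew_brace_hom_axioms) (simp_all add: surjB \<xi>_surj surjA flip: image_image image_comp)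
  show ?thesis
  proof (rule group_isoclinic_Lambda_cospan)
    show "\<theta> \<in> hom (word_brace A n) (word_brace B n)" "inj_on \<theta> (word_subgroup A n)"
      using \<theta> by (auto simp: brace_iso_def brace_hom_def bij_betw_def word_brace_def)
    fix m :: "comm_symbol list" and ps assume m: "length m = n" and ps: "ps \<in> tuples (carrier P) (n + 1)"
    have as: "map fst ps \<in> tuples (carrier A) (n + 1)" and bs: "map snd ps \<in> tuples (carrier B) (n + 1)"
      using ps by (auto simp: tuples_def)
    have "ann_cosets A n (map fst ps) \<in> tuples (carrier ?QA) (n + 1)"
      using as surjA by (auto simp: tuples_def ann_cosets_def)
    note phi[OF m this]
    moreover have "map \<xi> (ann_cosets A n (map fst ps)) = ann_cosets B n (map snd ps)"
      using ps by (auto simp: ann_cosets_def tuples_def)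
    ultimately show "\<theta> (word_val A m (map fst ps)) = word_val B m (map snd ps)"
      using phi_ann_cosets[OF assms(2) m as] phi_ann_cosets[OF assms(3) m bs] by simp
  qed
qed

end
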